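(* Let $\Sigma\subset H_1$ be a $p$-minimal surface. Then the characteristic foliation of $\Sigma$ is smooth around a singular curve in the following sense: each leaf (characteristic curve) around the singular curve can be extended smoothly to a point on the singular curve.
   Context: The Heisenberg group $H_1$ is $\mathbb{R}^3$ with the group law $(x_1,y_1,z_1)\circ(x_2,y_2,z_2)=(x_1+x_2,\,y_1+y_2,\,z_1+z_2+y_1x_2-x_1y_2)$. Left invariant fields: $\mathring e_1=\partial_x+y\partial_z$, $\mathring e_2=\partial_y-x\partial_z$, $T=\partial_z$. Contact form $\Theta=dz+x\,dy-y\,dx$, contact bundle $\xi=\ker\Theta$, $J\mathring e_1=\mathring e_2$, $J\mathring e_2=-\mathring e_1$; $\nabla$ is the connection for which $\mathring e_1,\mathring e_2,T$ are parallel, and the adapted metric makes them orthonormal. Surfaces are $C^\infty$. For a surface $\Sigma\subset H_1$, a point $p$ is singular if $T_p\Sigma=\xi_p$, otherwise regular. On the regular part choose a unit field $e_1\in T\Sigma\cap\xi$ (determined up to sign), $e_2=Je_1$; $H$ is defined by $\nabla_{e_1}e_2=-He_1$; $\Sigma$ is $p$-minimal if $H=0$ on the regular part. The line field $T\Sigma\cap\xi$ integrates on the regular part to the characteristic foliation, whose leaves (integral curves of $e_1$) are the characteristic curves. A singular curve is a ($C^1$) curve in $\Sigma$ consisting of singular points which near each of its points is the whole singular set. *)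

theory Defs
  imports "HOL-Analysis.Analysis"
begin

subsection \<open>Smooth maps on open sets\<close>

primrec Ck_on :: "nat \<Rightarrow> 'a::euclidean_space set \<Rightarrow> ('a \<Rightarrow> 'b::real_normed_vector) \<Rightarrow> bool" where
  "Ck_on 0 S f \<longleftrightarrow> continuous_on S f"
| "Ck_on (Suc n) S f \<longleftrightarrow>
     (\<forall>x\<in>S. f differentiable (at x)) \<and> (\<forall>v. Ck_on n S (\<lambda>x. frechet_derivative f (at x) v))"

definition smooth_on :: "'a::euclidean_space set \<Rightarrow> ('a \<Rightarrow> 'b::real_normed_vector) \<Rightarrow> bool" where
  "smooth_on S f \<longleftrightarrow> open S \<and> (\<forall>n. Ck_on n S f)"

subsection \<open>The Heisenberg group\<close>

text \<open>A point, and a tangent vector at it, is given by its coordinates in \<open>\<real>\<^sup>3\<close>.\<close>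

definition std_e1 :: "real^3 \<Rightarrow> real^3" where
  "std_e1 p = vector [1, 0, p$2]"

definition std_e2 :: "real^3 \<Rightarrow> real^3" where
  "std_e2 p = vector [0, 1, - p$1]"

definition std_T :: "real^3 \<Rightarrow> real^3" where
  "std_T p = vector [0, 0, 1]"

definition contact_form :: "real^3 \<Rightarrow> real^3 \<Rightarrow> real" where
  "contact_form p v = v$3 + p$1 * v$2 - p$2 * v$1"

definition contact_plane :: "real^3 \<Rightarrow> (real^3) set" where
  "contact_plane p = {v. contact_form p v = 0}"

text \<open>The components of a vector in the left invariant frame; the next three definitions use them.\<close>

lemma frame_decomposition:
  "v = v$1 *\<^sub>R std_e1 p + v$2 *\<^sub>R std_e2 p + contact_form p v *\<^sub>R std_T p"
  by (simp add: vec_eq_iff forall_3 std_e1_def std_e2_def std_T_def contact_form_def)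

definition adapted_metric :: "real^3 \<Rightarrow> real^3 \<Rightarrow> real^3 \<Rightarrow> real" where
  "adapted_metric p v w = v$1 * w$1 + v$2 * w$2 + contact_form p v * contact_form p w"

text \<open>Only the restriction to the contact plane matters; outside it \<open>contact_J\<close> is extended by \<open>J T = 0\<close>.\<close>

definition contact_J :: "real^3 \<Rightarrow> real^3 \<Rightarrow> real^3" where
  "contact_J p v = v$1 *\<^sub>R std_e2 p - v$2 *\<^sub>R std_e1 p"

text \<open>\<open>nabla p v X\<close> is the derivative at \<open>p\<close> in direction \<open>v\<close> of the vector field \<open>X\<close>, for the
  connection that makes the left invariant frame parallel: differentiate the frame components.\<close>

definition nabla :: "real^3 \<Rightarrow> real^3 \<Rightarrow> (real^3 \<Rightarrow> real^3) \<Rightarrow> real^3" where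
  "nabla p v X =
     frechet_derivative (\<lambda>q. X q $ 1) (at p) v *\<^sub>R std_e1 p +
     frechet_derivative (\<lambda>q. X q $ 2) (at p) v *\<^sub>R std_e2 p +
     frechet_derivative (\<lambda>q. contact_form q (X q)) (at p) v *\<^sub>R std_T p"

subsection \<open>Surfaces\<close>

text \<open>Embedded surfaces without boundary, by slice charts.\<close>

definition smooth_surface :: "(real^3) set \<Rightarrow> bool" where
  "smooth_surface \<Sigma> \<longleftrightarrow>
     (\<forall>p\<in>\<Sigma>. \<exists>U V (\<phi> :: real^3 \<Rightarrow> real^3) (\<psi> :: real^3 \<Rightarrow> real^3).
        p \<in> U \<and> smooth_on U \<phi> \<and> smooth_on V \<psi> \<and> homeomorphism U V \<phi> \<psi> \<and>
        \<Sigma> \<inter> U = {q \<in> U. \<phi> q $ 3 = 0})"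

definition tangent_plane :: "(real^3) set \<Rightarrow> real^3 \<Rightarrow> (real^3) set" where
  "tangent_plane \<Sigma> p =
     {v. \<exists>\<epsilon>>0. \<exists>c :: real \<Rightarrow> real^3.
        smooth_on {-\<epsilon><..<\<epsilon>} c \<and> c ` {-\<epsilon><..<\<epsilon>} \<subseteq> \<Sigma> \<and> c 0 = p \<and>
        (c has_vector_derivative v) (at 0)}"

definition singular_set :: "(real^3) set \<Rightarrow> (real^3) set" where
  "singular_set \<Sigma> = {p \<in> \<Sigma>. tangent_plane \<Sigma> p = contact_plane p}"

definition regular_part :: "(real^3) set \<Rightarrow> (real^3) set" where
  "regular_part \<Sigma> = \<Sigma> - singular_set \<Sigma>"

text \<open>\<open>e\<close> is a local choice, on \<open>\<Sigma> \<inter> U\<close>, of the unit characteristic field. A smooth field on a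
  surface is locally the restriction of a smooth ambient field, and \<open>e\<close> is such an extension;
  nothing is required of it off \<open>\<Sigma>\<close>.\<close>

definition char_field :: "(real^3) set \<Rightarrow> (real^3) set \<Rightarrow> (real^3 \<Rightarrow> real^3) \<Rightarrow> bool" where
  "char_field \<Sigma> U e \<longleftrightarrow>
     smooth_on U e \<and> \<Sigma> \<inter> U \<subseteq> regular_part \<Sigma> \<and>
     (\<forall>p\<in>\<Sigma> \<inter> U. e p \<in> tangent_plane \<Sigma> p \<inter> contact_plane p \<and> adapted_metric p (e p) (e p) = 1)"

text \<open>The p-mean curvature at \<open>p\<close> with respect to \<open>e\<close> is \<open>H\<close>. As \<open>e p\<close> is tangent to the surface,
  this does not depend on how \<open>e\<close> is extended off the surface. Replacing \<open>e\<close> by \<open>-e\<close> changes the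
  sign of \<open>H\<close>.\<close>

definition has_p_mean_curvature :: "(real^3 \<Rightarrow> real^3) \<Rightarrow> real^3 \<Rightarrow> real \<Rightarrow> bool" where
  "has_p_mean_curvature e p H \<longleftrightarrow> nabla p (e p) (\<lambda>q. contact_J q (e q)) = - (H *\<^sub>R e p)"

definition p_minimal_surface :: "(real^3) set \<Rightarrow> bool" where
  "p_minimal_surface \<Sigma> \<longleftrightarrow>
     smooth_surface \<Sigma> \<and>
     (\<forall>U e. char_field \<Sigma> U e \<longrightarrow> (\<forall>p\<in>\<Sigma> \<inter> U. has_p_mean_curvature e p 0))"

subsection \<open>The characteristic foliation\<close>

text \<open>The sign of the characteristic field is chosen locally along the curve, since there need not
  be a global choice on the regular part.\<close>

definition char_curve :: "(real^3) set \<Rightarrow> real set \<Rightarrow> (real \<Rightarrow> real^3) \<Rightarrow> bool" where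
  "char_curve \<Sigma> I c \<longleftrightarrow>
     open I \<and> is_interval I \<and> I \<noteq> {} \<and>
     (\<forall>t\<in>I. \<exists>U e. char_field \<Sigma> U e \<and>
        (\<forall>\<^sub>F s in nhds t. c s \<in> \<Sigma> \<inter> U \<and> (c has_vector_derivative e (c s)) (at s)))"

definition leaf :: "(real^3) set \<Rightarrow> real set \<Rightarrow> (real \<Rightarrow> real^3) \<Rightarrow> bool" where
  "leaf \<Sigma> I c \<longleftrightarrow>
     char_curve \<Sigma> I c \<and>
     (\<forall>I' c'. char_curve \<Sigma> I' c' \<and> I \<subseteq> I' \<and> (\<forall>t\<in>I. c' t = c t) \<longrightarrow> I' = I)"

text \<open>Regular \<open>C\<^sup>1\<close> curves without end points. The parametrization need not be injective, so closed
  curves are included.\<close>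

definition singular_curve :: "(real^3) set \<Rightarrow> (real^3) set \<Rightarrow> bool" where
  "singular_curve \<Sigma> \<Gamma> \<longleftrightarrow>
     (\<exists>I (\<gamma> :: real \<Rightarrow> real^3).
        open I \<and> is_interval I \<and> I \<noteq> {} \<and> \<gamma> C1_differentiable_on I \<and>
        (\<forall>t\<in>I. vector_derivative \<gamma> (at t) \<noteq> 0) \<and> \<Gamma> = \<gamma> ` I) \<and>
     \<Gamma> \<subseteq> singular_set \<Sigma> \<and>
     (\<forall>p\<in>\<Gamma>. \<exists>U. open U \<and> p \<in> U \<and> singular_set \<Sigma> \<inter> U = \<Gamma> \<inter> U)"

text \<open>The curve \<open>c\<close> on the open interval \<open>I\<close> extends smoothly to an end point \<open>b\<close> of \<open>I\<close> and has its
  value there in \<open>\<Gamma>\<close>. Smoothness up to \<open>b\<close> means that there is a smooth extension past \<open>b\<close>.\<close>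

definition extends_smoothly_to :: "real set \<Rightarrow> (real \<Rightarrow> real^3) \<Rightarrow> (real^3) set \<Rightarrow> bool" where
  "extends_smoothly_to I c \<Gamma> \<longleftrightarrow>
     (\<exists>b I' c'. b \<in> frontier I \<and> is_interval I' \<and> insert b I \<subseteq> I' \<and>
        smooth_on I' c' \<and> (\<forall>t\<in>I. c' t = c t) \<and> c' b \<in> \<Gamma>)"

end

theory Submission
  imports Defs
begin

text \<open>
  On a p-minimal surface the unit characteristic field has constant components in the left invariant
  frame along its own integral curves, so every leaf is a segment of a horizontal straight line with
  direction \<open>(u\<^sub>1, u\<^sub>2)\<close>. Conversely, a straight line that is characteristic at one regular point
  stays a leaf near that point, by a Gronwall argument. So a leaf can only end at a singular point or
  by leaving the neighbourhood under consideration.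

  Let \<open>g\<close> be a local defining function of the surface, \<open>g\<^sub>1\<close> and \<open>g\<^sub>2\<close> its derivatives along the
  frame fields (both vanish exactly at the singular points), and \<open>w\<close> the tangent of the singular curve
  at \<open>p\<close>. The function \<open>k = w\<^sub>1 g\<^sub>1 + w\<^sub>2 g\<^sub>2\<close> controls the whole gradient near \<open>p\<close>: both vanish on the
  singular curve, and \<open>k\<close> has nonzero derivative across it. Indeed, the bracket relation of the frame
  gives the horizontal derivative of \<open>k\<close> at \<open>p\<close> in direction \<open>u\<close> as \<open>2 g\<^sub>z(p) (w\<^sub>1 u\<^sub>2 - w\<^sub>2 u\<^sub>1)\<close>. As
  \<open>(g\<^sub>1, g\<^sub>2)\<close> is perpendicular to the direction \<open>u\<close> of the leaf, \<open>|k|\<close> is \<open>|w\<^sub>1 u\<^sub>2 - w\<^sub>2 u\<^sub>1|\<close> times the length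
  of the gradient. Hence the leaves are uniformly transversal to the singular curve, \<open>k\<close> has slope
  bounded away from zero along them, and a leaf close to \<open>p\<close> runs into a zero of \<open>k\<close> on a short
  segment. At such a point the gradient vanishes, so the leaf must end on the singular curve.
\<close>

section \<open>Calculus of smooth maps\<close>

lemma Ck_on_cong:
  assumes "open S" "\<And>x. x \<in> S \<Longrightarrow> f x = g x" "Ck_on n S f"
  shows "Ck_on n S g"
  using assms(2,3)
proof (induction n arbitrary: f g)
  case 0
  then show ?case by (simp cong: continuous_on_cong)
next
  case (Suc n)
  have hd: "(g has_derivative frechet_derivative f (at x)) (at x)" if "x \<in> S" for x
    using Suc.prems that assms(1) 
    by (metis Ck_on.simps(2) frechet_derivative_works has_derivative_transform_within_open)
  then have "g differentiable (at x)" if "x \<in> S" for x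
    using that differentiable_def by blast
  moreover have "Ck_on n S (\<lambda>x. frechet_derivative g (at x) v)" for v
  proof (rule Suc.IH)
    show "Ck_on n S (\<lambda>x. frechet_derivative f (at x) v)" using Suc.prems by simp
    show "frechet_derivative f (at x) v = frechet_derivative g (at x) v" if "x \<in> S" for x
      using frechet_derivative_at[OF hd[OF that]] by simp
  qed
  ultimately show ?case by simp
qed

lemma Ck_on_subset: "Ck_on n S f \<Longrightarrow> T \<subseteq> S \<Longrightarrow> Ck_on n T f"
  by (induction n arbitrary: f) (auto intro: continuous_on_subset)

lemma Ck_on_SucD: "Ck_on (Suc n) S f \<Longrightarrow> Ck_on n S f"
  by (induction n arbitrary: f)
    (auto intro: differentiable_imp_continuous_within continuous_at_imp_continuous_on)

text \<open>Lets the induction step work with any explicit formula for the derivative: on an open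
  set it agrees with \<open>frechet_derivative\<close> by uniqueness, and \<open>Ck_on_cong\<close>
  transfers the regularity.\<close>

lemma Ck_on_SucI:
  assumes "open S" "\<And>x. x \<in> S \<Longrightarrow> (f has_derivative f' x) (at x)"
    "\<And>v. Ck_on n S (\<lambda>x. f' x v)"
  shows "Ck_on (Suc n) S f"
proof -
  have "Ck_on n S (\<lambda>x. frechet_derivative f (at x) v)" for v
    by (rule Ck_on_cong[OF assms(1) _ assms(3)[of v]])
      (use assms(2) frechet_derivative_at in metis)
  then show ?thesis
    using assms(2) differentiable_def by (metis Ck_on.simps(2))
qed

lemma Ck_on_Suc_derivative:
  assumes "Ck_on (Suc n) S f" "x \<in> S"
  shows "(f has_derivative frechet_derivative f (at x)) (at x)"
  using assms frechet_derivative_works by auto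

lemma Ck_on_const: "open S \<Longrightarrow> Ck_on n S (\<lambda>x. c)"
  by (induction n arbitrary: c) (auto intro: Ck_on_SucI[where f'="\<lambda>_ _. 0"])

lemma Ck_on_add:
  assumes "open S" "Ck_on n S f" "Ck_on n S g"
  shows "Ck_on n S (\<lambda>x. f x + g x)"
  using assms(2,3)
proof (induction n arbitrary: f g)
  case 0
  then show ?case by (auto intro: continuous_intros)
next
  case (Suc n)
  show ?case
    by (rule Ck_on_SucI[OF assms(1) has_derivative_add[OF
          Ck_on_Suc_derivative[OF Suc.prems(1)] Ck_on_Suc_derivative[OF Suc.prems(2)]]])
      (use Suc in auto)
qed

lemma Ck_on_bounded_linear:
  assumes "open S" "bounded_linear h" "Ck_on n S f"
  shows "Ck_on n S (\<lambda>x. h (f x))"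
  using assms(3)
proof (induction n arbitrary: f)
  case 0
  then show ?case using assms(2) by (auto intro: bounded_linear.continuous_on)
next
  case (Suc n)
  show ?case
    by (rule Ck_on_SucI[OF assms(1) bounded_linear.has_derivative[OF assms(2)
          Ck_on_Suc_derivative[OF Suc.prems]]])
      (use Suc in auto)
qed

lemma Ck_on_scaleR:
  fixes f :: "_ \<Rightarrow> real"
  assumes "open S" "Ck_on n S f" "Ck_on n S g"
  shows "Ck_on n S (\<lambda>x. f x *\<^sub>R g x)"
  using assms(2,3)
proof (induction n arbitrary: f g)
  case 0
  then show ?case by (auto intro: continuous_intros)
next
  case (Suc n)
  show ?case
    by (rule Ck_on_SucI[OF assms(1) has_derivative_scaleR[OF
          Ck_on_Suc_derivative[OF Suc.prems(1)] Ck_on_Suc_derivative[OF Suc.prems(2)]]])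
      (use Suc.IH Suc.prems Ck_on_SucD[OF Suc.prems(1)] Ck_on_SucD[OF Suc.prems(2)] in
        \<open>auto intro!: Ck_on_add assms(1)\<close>)
qed

text \<open>Differentiation lowers the exponent, so the induction runs over all \<open>r\<close> at
  once. The application is the reciprocal length of the horizontal gradient.\<close>

lemma Ck_on_powr:
  fixes f :: "_ \<Rightarrow> real"
  assumes "open S" "Ck_on n S f" "\<And>x. x \<in> S \<Longrightarrow> 0 < f x"
  shows "Ck_on n S (\<lambda>x. f x powr r)"
  using assms(2)
proof (induction n arbitrary: r)
  case 0
  then show ?case using assms(3) by (auto intro!: continuous_on_powr) (metis less_irrefl)
next
  case (Suc n)
  show ?case
  proof (rule Ck_on_SucI[OF assms(1)])
    fix x assume x: "x \<in> S"
    show "((\<lambda>x. f x powr r) has_derivative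
        (\<lambda>v. (r * f x powr (r - 1)) *\<^sub>R frechet_derivative f (at x) v)) (at x)"
      using has_derivative_compose[OF Ck_on_Suc_derivative[OF Suc.prems x]
          has_real_derivative_powr[OF assms(3)[OF x], of r, unfolded has_field_derivative_def]]
      by (simp add: mult_ac)
  next
    fix v
    have "Ck_on n S (\<lambda>x. r *\<^sub>R (f x powr (r - 1)))"
      by (rule Ck_on_bounded_linear[OF assms(1) bounded_linear_scaleR_right
          Suc.IH[OF Ck_on_SucD[OF Suc.prems]]])
    then show "Ck_on n S (\<lambda>x. (r * f x powr (r - 1)) *\<^sub>R frechet_derivative f (at x) v)"
      using Suc.prems by (intro Ck_on_scaleR assms(1)) auto
  qed
qed

text \<open>Along a line the direction is fixed, so the derivative of the composition is again a
  fixed directional derivative of \<open>f\<close> on the same line, and the induction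
  closes.\<close>

lemma Ck_on_compose_line:
  fixes f :: "'a::euclidean_space \<Rightarrow> 'b::real_normed_vector" and T :: "real set"
  assumes "open S" "open T" "\<And>t. t \<in> T \<Longrightarrow> a + t *\<^sub>R v \<in> S" "Ck_on n S f"
  shows "Ck_on n T (\<lambda>t. f (a + t *\<^sub>R v))"
  using assms(4)
proof (induction n arbitrary: f)
  case 0
  then show ?case
    using assms(3)
    by (auto intro!: continuous_on_compose2[where f="\<lambda>t. a + t *\<^sub>R v"] continuous_intros)
next
  case (Suc n)
  show ?case
  proof (rule Ck_on_SucI[OF assms(2)])
    fix t assume t: "t \<in> T"
    have "((\<lambda>t. a + t *\<^sub>R v) has_derivative (\<lambda>s. s *\<^sub>R v)) (at t)"
      by (auto intro!: derivative_eq_intros)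
    from has_derivative_compose[OF this Ck_on_Suc_derivative[OF Suc.prems assms(3)[OF t]]]
    show "((\<lambda>t. f (a + t *\<^sub>R v)) has_derivative
        (\<lambda>s. frechet_derivative f (at (a + t *\<^sub>R v)) (s *\<^sub>R v))) (at t)" .
  qed (use Suc in auto)
qed

lemma smooth_on_Ck: "smooth_on S f \<Longrightarrow> Ck_on n S f"
  and smooth_on_open: "smooth_on S f \<Longrightarrow> open S"
  by (auto simp: smooth_on_def)

lemma smooth_on_subset: "smooth_on S f \<Longrightarrow> open T \<Longrightarrow> T \<subseteq> S \<Longrightarrow> smooth_on T f"
  by (auto simp: smooth_on_def intro: Ck_on_subset)

lemma smooth_on_const: "open S \<Longrightarrow> smooth_on S (\<lambda>x. c)"
  by (simp add: smooth_on_def Ck_on_const)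

lemma smooth_on_add: "smooth_on S f \<Longrightarrow> smooth_on S g \<Longrightarrow> smooth_on S (\<lambda>x. f x + g x)"
  by (simp add: smooth_on_def Ck_on_add)

lemma smooth_on_scaleR:
  "smooth_on S f \<Longrightarrow> smooth_on S g \<Longrightarrow> smooth_on S (\<lambda>x. (f x :: real) *\<^sub>R g x)"
  by (simp add: smooth_on_def Ck_on_scaleR)

lemma smooth_on_mult:
  "smooth_on S f \<Longrightarrow> smooth_on S g \<Longrightarrow> smooth_on S (\<lambda>x. (f x :: real) * g x)"
  using smooth_on_scaleR[of S f g] by simp

lemma smooth_on_bounded_linear:
  "smooth_on S f \<Longrightarrow> bounded_linear h \<Longrightarrow> smooth_on S (\<lambda>x. h (f x))"
  by (simp add: smooth_on_def Ck_on_bounded_linear)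

lemma smooth_on_powr:
  "smooth_on S f \<Longrightarrow> (\<And>x. x \<in> S \<Longrightarrow> (0::real) < f x) \<Longrightarrow> smooth_on S (\<lambda>x. f x powr r)"
  by (simp add: smooth_on_def Ck_on_powr)

lemma smooth_on_ident: "open S \<Longrightarrow> smooth_on S (\<lambda>x. x)"
  unfolding smooth_on_def
proof (intro conjI allI)
  fix n assume "open S"
  then show "Ck_on n S (\<lambda>x. x)"
    by (cases n) (auto intro: Ck_on_SucI[where f'="\<lambda>_ v. v"] Ck_on_const)
qed

lemma smooth_on_has_derivative:
  "smooth_on S f \<Longrightarrow> x \<in> S \<Longrightarrow> (f has_derivative frechet_derivative f (at x)) (at x)"
  using Ck_on_Suc_derivative[of 0] smooth_on_Ck by blast

lemma smooth_on_frechet_derivative: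
  "smooth_on S f \<Longrightarrow> smooth_on S (\<lambda>x. frechet_derivative f (at x) v)"
  by (metis Ck_on.simps(2) smooth_on_def)

lemma smooth_on_continuous: "smooth_on S f \<Longrightarrow> x \<in> S \<Longrightarrow> continuous (at x) f"
  using smooth_on_has_derivative has_derivative_continuous by blast

lemma smooth_on_sum:
  "finite B \<Longrightarrow> open S \<Longrightarrow> (\<And>b. b \<in> B \<Longrightarrow> smooth_on S (f b)) \<Longrightarrow> smooth_on S (\<lambda>x. \<Sum>b\<in>B. f b x)"
  by (induction B rule: finite_induct) (auto intro: smooth_on_const smooth_on_add)

lemma linear_Basis_expansion:
  fixes h :: "'a::euclidean_space \<Rightarrow> 'b::real_vector"
  assumes "linear h"
  shows "h v = (\<Sum>b\<in>Basis. (v \<bullet> b) *\<^sub>R h b)"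
  by (metis (no_types, lifting) assms euclidean_representation linear_scale linear_sum sum.cong)

text \<open>Expanding \<open>X x\<close> in the standard basis reduces a variable direction to fixed
  directions with smooth coefficients; fixed directions are what \<open>Ck_on\<close> speaks
  about.\<close>

lemma smooth_on_directional_derivative:
  fixes f :: "'a::euclidean_space \<Rightarrow> 'b::real_normed_vector"
  assumes f: "smooth_on S f" and X: "smooth_on S X"
  shows "smooth_on S (\<lambda>x. frechet_derivative f (at x) (X x))"
proof -
  have "smooth_on S (\<lambda>x. \<Sum>b\<in>Basis. (X x \<bullet> b) *\<^sub>R frechet_derivative f (at x) b)"
    using f X
    by (intro smooth_on_sum smooth_on_scaleR smooth_on_frechet_derivative
        smooth_on_bounded_linear[OF X bounded_linear_inner_left] smooth_on_open[OF f]) auto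
  moreover have "frechet_derivative f (at x) (X x) =
      (\<Sum>b\<in>Basis. (X x \<bullet> b) *\<^sub>R frechet_derivative f (at x) b)" if "x \<in> S" for x
    by (intro linear_Basis_expansion has_derivative_linear[OF smooth_on_has_derivative[OF f that]])
  ultimately show ?thesis
    unfolding smooth_on_def by (metis (mono_tags, lifting) Ck_on_cong)
qed

section \<open>Uniform estimates near a point\<close>

text \<open>Continuity of the derivative as an operator, from that of the finitely many partial
  derivatives: each of the \<open>DIM('a)\<close> summands gets the share
  \<open>\<epsilon> / ?c\<close>.\<close>

lemma smooth_on_derivative_close:
  fixes f :: "'a::euclidean_space \<Rightarrow> 'b::real_normed_vector"
  assumes f: "smooth_on S f" and p: "p \<in> S" and "\<epsilon> > 0"
  obtains r where "r > 0" "ball p r \<subseteq> S"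
    "\<And>x v. x \<in> ball p r \<Longrightarrow>
      norm (frechet_derivative f (at x) v - frechet_derivative f (at p) v) \<le> \<epsilon> * norm v"
proof -
  let ?D = "\<lambda>x. frechet_derivative f (at x)"
  let ?c = "real DIM('a)"
  have c: "?c > 0" by simp
  have lin: "linear (?D x)" if "x \<in> S" for x
    by (intro has_derivative_linear[OF smooth_on_has_derivative[OF f that]])
  have "\<forall>\<^sub>F x in at p. \<forall>b\<in>Basis. dist (?D x b) (?D p b) < \<epsilon> / ?c"
  proof (intro eventually_ball_finite ballI)
    fix b :: 'a
    have "((\<lambda>x. ?D x b) \<longlongrightarrow> ?D p b) (at p)"
      using smooth_on_continuous[OF smooth_on_frechet_derivative[OF f] p] by (simp add: isCont_def)
    then show "\<forall>\<^sub>F x in at p. dist (?D x b) (?D p b) < \<epsilon> / ?c"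
      using c \<open>\<epsilon> > 0\<close> by (intro tendstoD) auto
  qed simp
  then obtain r1 where r1: "r1 > 0"
    "\<And>x b. x \<noteq> p \<Longrightarrow> dist x p < r1 \<Longrightarrow> b \<in> Basis \<Longrightarrow> dist (?D x b) (?D p b) < \<epsilon> / ?c"
    unfolding eventually_at by auto
  obtain r2 where r2: "r2 > 0" "ball p r2 \<subseteq> S"
    using smooth_on_open[OF f] p open_contains_ball by blast
  define r where "r = min r1 r2"
  show thesis
  proof
    show "r > 0" using r1 r2 by (simp add: r_def)
    show rS: "ball p r \<subseteq> S" using r2 by (auto simp: r_def)
    fix x v assume x: "x \<in> ball p r"
    have xS: "x \<in> S" using x rS by auto
    have "?D x v - ?D p v = (\<Sum>b\<in>Basis. (v \<bullet> b) *\<^sub>R (?D x b - ?D p b))"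
      using linear_Basis_expansion[OF lin[OF xS], of v] linear_Basis_expansion[OF lin[OF p], of v]
      by (simp add: scaleR_diff_right sum_subtractf)
    also have "norm \<dots> \<le> (\<Sum>b\<in>(Basis::'a set). norm v * (\<epsilon> / ?c))"
    proof (rule sum_norm_le)
      fix b :: 'a assume b: "b \<in> Basis"
      have "norm (?D x b - ?D p b) \<le> \<epsilon> / ?c"
        using r1(2)[of x b] x b \<open>\<epsilon> > 0\<close> c
        by (cases "x = p") (auto simp: r_def dist_norm norm_minus_commute less_imp_le)
      then show "norm ((v \<bullet> b) *\<^sub>R (?D x b - ?D p b)) \<le> norm v * (\<epsilon> / ?c)"
        using Basis_le_norm[OF b, of v] by (simp only: norm_scaleR) (intro mult_mono, auto)
    qed
    also have "\<dots> = \<epsilon> * norm v" using c by simp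
    finally show "norm (?D x v - ?D p v) \<le> \<epsilon> * norm v" .
  qed
qed

lemma smooth_on_derivative_bounded:
  fixes f :: "'a::euclidean_space \<Rightarrow> 'b::real_normed_vector"
  assumes f: "smooth_on S f" and p: "p \<in> S"
  obtains r M where "r > 0" "M > 0" "ball p r \<subseteq> S"
    "\<And>x v. x \<in> ball p r \<Longrightarrow> norm (frechet_derivative f (at x) v) \<le> M * norm v"
proof -
  obtain r where r: "r > 0" "ball p r \<subseteq> S"
    "\<And>x v. x \<in> ball p r \<Longrightarrow>
      norm (frechet_derivative f (at x) v - frechet_derivative f (at p) v) \<le> 1 * norm v"
    using smooth_on_derivative_close[OF f p, of 1] by auto
  have bl: "bounded_linear (frechet_derivative f (at p))"
    by (intro has_derivative_bounded_linear[OF smooth_on_has_derivative[OF f p]])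
  show thesis
  proof
    show "r > 0" "ball p r \<subseteq> S" by fact+
    show "1 + onorm (frechet_derivative f (at p)) > 0" using onorm_pos_le[OF bl] by simp
    fix x v assume "x \<in> ball p r"
    from r(3)[OF this, of v] onorm[OF bl, of v]
      norm_triangle_sub[of "frechet_derivative f (at x) v" "frechet_derivative f (at p) v"]
    show "norm (frechet_derivative f (at x) v) \<le> (1 + onorm (frechet_derivative f (at p))) * norm v"
      by (simp add: algebra_simps)
  qed
qed

lemma segment_in_ball:
  fixes x y :: "'a::real_normed_vector"
  assumes "x \<in> ball p r" "y \<in> ball p r" "t \<in> {0..1}"
  shows "x + t *\<^sub>R (y - x) \<in> ball p r"
proof -
  have "x + t *\<^sub>R (y - x) = (1 - t) *\<^sub>R x + t *\<^sub>R y" by (simp add: algebra_simps)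
  then show ?thesis
    using convexD_alt[OF convex_ball assms(1,2), of t] assms(3) by simp
qed

text \<open>Strict differentiability, from the mean value inequality on a convex ball. Both points
  vary, so that a point of the surface can later be compared with a point of the singular curve
  other than \<open>p\<close>.\<close>

lemma smooth_on_strict_derivative:
  fixes f :: "'a::euclidean_space \<Rightarrow> 'b::real_normed_vector"
  assumes f: "smooth_on S f" and p: "p \<in> S" and e: "\<epsilon> > 0"
  obtains r where "r > 0" "ball p r \<subseteq> S"
    "\<And>x y. x \<in> ball p r \<Longrightarrow> y \<in> ball p r \<Longrightarrow>
       norm (f y - f x - frechet_derivative f (at p) (y - x)) \<le> \<epsilon> * norm (y - x)"
proof -
  let ?D = "\<lambda>x. frechet_derivative f (at x)"
  obtain r where r: "r > 0" "ball p r \<subseteq> S"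
    "\<And>x v. x \<in> ball p r \<Longrightarrow> norm (?D x v - ?D p v) \<le> \<epsilon> * norm v"
    using smooth_on_derivative_close[OF f p e] by blast
  have "norm (f y - f x - ?D p (y - x)) \<le> \<epsilon> * norm (y - x)"
    if xy: "x \<in> ball p r" "y \<in> ball p r" for x y
  proof -
    have "norm (f y - f x - ?D p (y - x)) \<le> norm (y - x) * \<epsilon>"
    proof (rule differentiable_bound_linearization[where S="ball p r"])
      show "x + t *\<^sub>R (y - x) \<in> ball p r" if "t \<in> {0..1}" for t :: real
        by (rule segment_in_ball[OF xy that])
      fix x assume "x \<in> ball p r"
      then show "(f has_derivative ?D x) (at x within ball p r)"
        using smooth_on_has_derivative[OF f] r has_derivative_at_withinI by blast
    qed (use r e in \<open>auto intro!: onorm_le\<close>)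
    then show ?thesis by (simp add: mult.commute)
  qed
  with r that show thesis by blast
qed

lemma smooth_on_Lipschitz:
  fixes f :: "'a::euclidean_space \<Rightarrow> 'b::real_normed_vector"
  assumes f: "smooth_on S f" and p: "p \<in> S"
  obtains r L where "r > 0" "L > 0" "ball p r \<subseteq> S"
    "\<And>x y. x \<in> ball p r \<Longrightarrow> y \<in> ball p r \<Longrightarrow> norm (f y - f x) \<le> L * norm (y - x)"
proof -
  obtain r where r: "r > 0" "ball p r \<subseteq> S"
    "\<And>x y. x \<in> ball p r \<Longrightarrow> y \<in> ball p r \<Longrightarrow>
       norm (f y - f x - frechet_derivative f (at p) (y - x)) \<le> 1 * norm (y - x)"
    using smooth_on_strict_derivative[OF f p, of 1] by auto
  have bl: "bounded_linear (frechet_derivative f (at p))"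
    by (intro has_derivative_bounded_linear[OF smooth_on_has_derivative[OF f p]])
  show thesis
  proof
    show "r > 0" "ball p r \<subseteq> S" by fact+
    show "1 + onorm (frechet_derivative f (at p)) > 0" using onorm_pos_le[OF bl] by simp
    fix x y assume "x \<in> ball p r" "y \<in> ball p r"
    from r(3)[OF this] onorm[OF bl, of "y - x"] norm_triangle_sub[of "f y - f x" "frechet_derivative f (at p) (y - x)"]
    show "norm (f y - f x) \<le> (1 + onorm (frechet_derivative f (at p))) * norm (y - x)"
      by (simp add: algebra_simps)
  qed
qed

section \<open>Symmetry of second derivatives\<close>

text \<open>The mean value theorem in direction \<open>a\<close> turns the second difference over a
  small parallelogram into an increment of the derivative along \<open>a\<close>, which strict
  differentiability evaluates. The second difference itself is symmetric in \<open>a\<close> and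
  \<open>b\<close>.\<close>

lemma second_derivative_le:
  fixes f :: "'a::euclidean_space \<Rightarrow> real"
  assumes f: "smooth_on S f" and p: "p \<in> S" and e: "\<epsilon> > 0"
  obtains \<delta> where "\<delta> > 0"
    "\<And>s. 0 < s \<Longrightarrow> s < \<delta> \<Longrightarrow>
      \<bar>(f (p + s *\<^sub>R a + s *\<^sub>R b) - f (p + s *\<^sub>R a) - f (p + s *\<^sub>R b) + f p) -
        s\<^sup>2 * frechet_derivative (\<lambda>x. frechet_derivative f (at x) a) (at p) b\<bar> \<le> s\<^sup>2 * (\<epsilon> * norm b)"
proof -
  let ?F = "\<lambda>x. frechet_derivative f (at x) a"
  obtain r where r: "r > 0" "ball p r \<subseteq> S"
    "\<And>x y. x \<in> ball p r \<Longrightarrow> y \<in> ball p r \<Longrightarrow>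
       norm (?F y - ?F x - frechet_derivative ?F (at p) (y - x)) \<le> \<epsilon> * norm (y - x)"
    using smooth_on_strict_derivative[OF smooth_on_frechet_derivative[OF f] p e] by metis
  have lin: "linear (frechet_derivative ?F (at p))"
    by (intro has_derivative_linear[OF smooth_on_has_derivative[OF smooth_on_frechet_derivative[OF f] p]])
  \<comment> \<open>Keeps the whole parallelogram in the ball; the summand \<open>1\<close> keeps
    the denominator positive when \<open>a\<close> and \<open>b\<close> vanish.\<close>
  define \<delta> where "\<delta> = r / (norm a + norm b + 1)"
  have pos: "norm a + norm b + 1 > 0" by (smt (verit) norm_ge_zero)
  show thesis
  proof
    show "\<delta> > 0" using r pos by (simp add: \<delta>_def)
    fix s :: real assume s: "0 < s" "s < \<delta>"
    have in_ball: "p + t *\<^sub>R a + u *\<^sub>R b \<in> ball p r" if "0 \<le> t" "t \<le> s" "0 \<le> u" "u \<le> s" for t u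
    proof -
      have "norm (t *\<^sub>R a + u *\<^sub>R b) \<le> s * norm a + s * norm b"
        using that by (intro order.trans[OF norm_triangle_ineq] add_mono) (auto intro: mult_right_mono)
      also have "\<dots> \<le> s * (norm a + norm b + 1)" using s by (simp add: algebra_simps)
      also have "\<dots> < r" using s pos by (simp add: \<delta>_def field_simps)
      finally have "norm (t *\<^sub>R a + u *\<^sub>R b) < r" .
      moreover have "dist p (p + w) = norm w" for w by (simp add: dist_norm)
      ultimately show ?thesis by (simp add: add.assoc)
    qed
    \<comment> \<open>Increment in direction \<open>b\<close> as a function of the position along
      \<open>a\<close>; \<open>?\<phi> s - ?\<phi> 0\<close> is the second difference.\<close>
    let ?\<phi> = "\<lambda>t. f (p + t *\<^sub>R a + s *\<^sub>R b) - f (p + t *\<^sub>R a)"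
    have "\<exists>t. t > 0 \<and> t < s \<and> ?\<phi> s - ?\<phi> 0 =
        (s - 0) * (?F (p + t *\<^sub>R a + s *\<^sub>R b) - ?F (p + t *\<^sub>R a))"
    proof (rule MVT2[OF s(1)])
      fix t :: real assume t: "0 \<le> t" "t \<le> s"
      have 1: "((\<lambda>t. p + t *\<^sub>R a + c) has_derivative (\<lambda>h. h *\<^sub>R a)) (at t)" for c
        by (auto intro!: derivative_eq_intros)
      have 2: "((\<lambda>t. f (p + t *\<^sub>R a + c)) has_derivative (\<lambda>h. h * ?F (p + t *\<^sub>R a + c))) (at t)"
        if "p + t *\<^sub>R a + c \<in> S" for c
      proof -
        have "linear (frechet_derivative f (at (p + t *\<^sub>R a + c)))"
          by (intro has_derivative_linear[OF smooth_on_has_derivative[OF f that]])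
        then show ?thesis
          using has_derivative_compose[OF 1 smooth_on_has_derivative[OF f that]]
          by (simp add: linear_scale)
      qed
      from 2[of "s *\<^sub>R b"] 2[of 0] in_ball[OF t, of s] in_ball[OF t, of 0] s r(2)
      show "(?\<phi> has_real_derivative (?F (p + t *\<^sub>R a + s *\<^sub>R b) - ?F (p + t *\<^sub>R a))) (at t)"
        unfolding has_field_derivative_def
        by (auto intro!: derivative_eq_intros simp: algebra_simps)
    qed
    then obtain t where t: "t > 0" "t < s" "?\<phi> s - ?\<phi> 0 = s * (?F (p + t *\<^sub>R a + s *\<^sub>R b) - ?F (p + t *\<^sub>R a))"
      by auto
    have "\<bar>?F (p + t *\<^sub>R a + s *\<^sub>R b) - ?F (p + t *\<^sub>R a) - s * frechet_derivative ?F (at p) b\<bar> \<le> \<epsilon> * (s * norm b)"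
      using r(3)[OF in_ball[of t 0] in_ball[of t s]] t s by (simp add: linear_scale[OF lin])
    then have "s * \<bar>?F (p + t *\<^sub>R a + s *\<^sub>R b) - ?F (p + t *\<^sub>R a) - s * frechet_derivative ?F (at p) b\<bar> \<le> s * (\<epsilon> * (s * norm b))"
      using s by (intro mult_left_mono) auto
    moreover have "s * \<bar>?F (p + t *\<^sub>R a + s *\<^sub>R b) - ?F (p + t *\<^sub>R a) - s * frechet_derivative ?F (at p) b\<bar>
      = \<bar>(?\<phi> s - ?\<phi> 0) - s\<^sup>2 * frechet_derivative ?F (at p) b\<bar>"
      unfolding t(3) using s by (simp add: abs_mult_pos' power2_eq_square algebra_simps)
    ultimately show "\<bar>(f (p + s *\<^sub>R a + s *\<^sub>R b) - f (p + s *\<^sub>R a) - f (p + s *\<^sub>R b) + f p) -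
        s\<^sup>2 * frechet_derivative ?F (at p) b\<bar> \<le> s\<^sup>2 * (\<epsilon> * norm b)"
      by (simp add: power2_eq_square algebra_simps)
  qed
qed

text \<open>Schwarz's theorem: the same second difference approximates \<open>s\<^sup>2 * ?A\<close>
  and \<open>s\<^sup>2 * ?B\<close>, and division by \<open>s\<^sup>2\<close> leaves an arbitrarily
  small error.\<close>

lemma second_derivative_symmetric:
  fixes f :: "'a::euclidean_space \<Rightarrow> real"
  assumes f: "smooth_on S f" and p: "p \<in> S"
  shows "frechet_derivative (\<lambda>x. frechet_derivative f (at x) a) (at p) b =
    frechet_derivative (\<lambda>x. frechet_derivative f (at x) b) (at p) a" (is "?A = ?B")
proof -
  have "\<bar>?A - ?B\<bar> \<le> \<epsilon> * (norm a + norm b)" if e: "\<epsilon> > 0" for \<epsilon>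
  proof -
    let ?\<Delta> = "\<lambda>s. f (p + s *\<^sub>R a + s *\<^sub>R b) - f (p + s *\<^sub>R a) - f (p + s *\<^sub>R b) + f p"
    obtain d1 where d1: "d1 > 0" "\<And>s. 0 < s \<Longrightarrow> s < d1 \<Longrightarrow> \<bar>?\<Delta> s - s\<^sup>2 * ?A\<bar> \<le> s\<^sup>2 * (\<epsilon> * norm b)"
      using second_derivative_le[OF f p e, of a b] by blast
    obtain d2 where d2: "d2 > 0" "\<And>s. 0 < s \<Longrightarrow> s < d2 \<Longrightarrow>
        \<bar>(f (p + s *\<^sub>R b + s *\<^sub>R a) - f (p + s *\<^sub>R b) - f (p + s *\<^sub>R a) + f p) - s\<^sup>2 * ?B\<bar> \<le> s\<^sup>2 * (\<epsilon> * norm a)"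
      using second_derivative_le[OF f p e, of b a] by blast
    define s where "s = min d1 d2 / 2"
    have s: "0 < s" "s < d1" "s < d2" using d1 d2 by (auto simp: s_def)
    have "p + s *\<^sub>R b + s *\<^sub>R a = p + s *\<^sub>R a + s *\<^sub>R b" by simp
    then have "\<bar>s\<^sup>2 * ?A - s\<^sup>2 * ?B\<bar> \<le> s\<^sup>2 * (\<epsilon> * (norm a + norm b))"
      using d1(2)[OF s(1,2)] d2(2)[OF s(1,3)] by (simp add: algebra_simps)
    then have "s\<^sup>2 * \<bar>?A - ?B\<bar> \<le> s\<^sup>2 * (\<epsilon> * (norm a + norm b))"
      by (simp add: abs_mult flip: right_diff_distrib)
    then show ?thesis using s by simp
  qed
  then have "\<bar>?A - ?B\<bar> \<le> 0 + e" if "e > 0" for e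
    using that \<open>\<And>\<epsilon>. \<epsilon> > 0 \<Longrightarrow> _\<close>[of "e / (norm a + norm b + 1)"]
    by (smt (verit, ccfv_SIG) divide_less_cancel divide_pos_pos mult_le_cancel_left_pos nonzero_divide_eq_eq norm_ge_zero)
  then have "\<bar>?A - ?B\<bar> \<le> 0" by (rule field_le_epsilon)
  then show ?thesis by simp
qed

section \<open>Differential inequalities and limits along curves\<close>

text \<open>Gronwall's argument: the squared norm of \<open>Y\<close> grows at most at rate
  \<open>2 * K\<close> in either direction of time, so with an exponential weight it cannot increase
  away from \<open>0\<close>, where it vanishes.\<close>

lemma vanishing_of_differential_inequality:
  fixes Y :: "real \<Rightarrow> 'a::real_inner"
  assumes d: "\<And>s. \<bar>s\<bar> < \<delta> \<Longrightarrow> (Y has_vector_derivative Y' s) (at s)"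
    and le: "\<And>s. \<bar>s\<bar> < \<delta> \<Longrightarrow> norm (Y' s) \<le> K * norm (Y s)"
    and 0: "Y 0 = 0" and s: "\<bar>s\<bar> < \<delta>"
  shows "Y s = 0"
proof -
  have le': "\<bar>Y s \<bullet> Y' s\<bar> \<le> K * (Y s \<bullet> Y s)" if "\<bar>s\<bar> < \<delta>" for s
    using Cauchy_Schwarz_ineq2[of "Y s" "Y' s"] mult_left_mono[OF le[OF that], of "norm (Y s)"]
    by (simp add: power2_norm_eq_inner[symmetric] power2_eq_square mult_ac)
  have dE: "((\<lambda>s. Y s \<bullet> Y s) has_real_derivative 2 * (Y s \<bullet> Y' s)) (at s)" if "\<bar>s\<bar> < \<delta>" for s
    using d[OF that] unfolding has_vector_derivative_def has_field_derivative_def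
    by (auto intro!: derivative_eq_intros simp: inner_commute algebra_simps)
  \<comment> \<open>Squared norm with an integrating factor; \<open>c\<close> will be
    \<open>- 2 * K\<close> forward in time and \<open>2 * K\<close> backward.\<close>
  define E where "E c s = (Y s \<bullet> Y s) * exp (c * s)" for c s
  have E: "(E c has_real_derivative (2 * (Y s \<bullet> Y' s) + c * (Y s \<bullet> Y s)) * exp (c * s)) (at s)"
    if "\<bar>s\<bar> < \<delta>" for s c
    unfolding E_def using dE[OF that] by (auto intro!: derivative_eq_intros simp: algebra_simps)
  have "Y s \<bullet> Y s \<le> 0"
  proof (cases "0 \<le> s")
    case True
    have "E (- 2 * K) s \<le> E (- 2 * K) 0"
    proof (rule DERIV_nonpos_imp_nonincreasing[OF True])
      fix x assume "0 \<le> x" "x \<le> s"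
      then have x: "\<bar>x\<bar> < \<delta>" using s by auto
      show "\<exists>y. (E (- 2 * K) has_real_derivative y) (at x) \<and> y \<le> 0"
        using E[OF x, of "- 2 * K"] le'[OF x] by (intro exI conjI) (auto simp: mult_le_0_iff)
    qed
    then show ?thesis by (simp add: E_def 0 mult_le_0_iff)
  next
    case False
    have "E (2 * K) s \<le> E (2 * K) 0"
    proof (rule DERIV_nonneg_imp_nondecreasing[of s 0 "E (2 * K)"])
      fix x assume "s \<le> x" "x \<le> 0"
      then have x: "\<bar>x\<bar> < \<delta>" using s by auto
      show "\<exists>y. (E (2 * K) has_real_derivative y) (at x) \<and> 0 \<le> y"
        using E[OF x, of "2 * K"] le'[OF x] by (intro exI conjI) auto
    qed (use False in simp)
    then show ?thesis by (simp add: E_def 0 mult_le_0_iff)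
  qed
  then show ?thesis by (metis inner_eq_zero_iff inner_ge_zero order_antisym)
qed

lemma isCont_eventually_nhds:
  "isCont f x \<Longrightarrow> open S \<Longrightarrow> f x \<in> S \<Longrightarrow> \<forall>\<^sub>F y in nhds x. f y \<in> S"
  by (simp add: isCont_def tendsto_at_iff_tendsto_nhds topological_tendstoD)

text \<open>At an end point of the interval of a leaf the equations of the surface are known only on
  the side of the interval; continuity carries them over.\<close>

lemma closure_zero:
  fixes F :: "real \<Rightarrow> real"
  assumes "isCont F b" "b \<in> closure I" "\<forall>\<^sub>F t in nhds b. t \<in> I \<longrightarrow> F t = 0"
  shows "F b = 0"
proof (rule ccontr)
  assume "F b \<noteq> 0"
  then have "\<forall>\<^sub>F t in nhds b. F t \<noteq> 0"
    using assms(1) tendsto_imp_eventually_ne[of F "F b" "at b" 0]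
    by (simp add: isCont_def eventually_nhds_conv_at)
  with assms(3) have "\<forall>\<^sub>F t in nhds b. t \<notin> I" by eventually_elim auto
  then show False
    using assms(2) by (auto simp: eventually_nhds closure_iff_nhds_not_empty)
qed

lemma smooth_on_line: "smooth_on UNIV (\<lambda>t :: real. P + t *\<^sub>R u)"
  by (intro smooth_on_add smooth_on_const smooth_on_scaleR smooth_on_ident open_UNIV)

text \<open>The function \<open>w \<bullet> \<gamma> t\<close> has derivative
  \<open>w \<bullet> w > 0\<close> at \<open>t0\<close>, so by the intermediate value theorem it
  takes all values close to the one at \<open>t0\<close>. This stands in for a nearest-point
  projection to the curve.\<close>

lemma curve_meets_normal_hyperplanes:
  fixes \<gamma> :: "real \<Rightarrow> 'a::real_inner"
  assumes I: "open I" "connected I" "t0 \<in> I" and \<gamma>: "continuous_on I \<gamma>"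
    and w: "(\<gamma> has_vector_derivative w) (at t0)" "w \<noteq> 0" and R: "R > 0"
  shows "\<forall>\<^sub>F x in nhds (\<gamma> t0). \<exists>t\<in>I. \<gamma> t \<in> ball (\<gamma> t0) R \<and> w \<bullet> (x - \<gamma> t) = 0"
proof -
  have "isCont \<gamma> t0" using I \<gamma> continuous_on_eq_continuous_at by blast
  then have "\<forall>\<^sub>F t in nhds t0. \<gamma> t \<in> ball (\<gamma> t0) R"
    by (rule isCont_eventually_nhds) (use R in auto)
  moreover have "\<forall>\<^sub>F t in nhds t0. t \<in> I" using I by (intro eventually_nhds_in_open)
  ultimately have "\<forall>\<^sub>F t in nhds t0. t \<in> I \<and> \<gamma> t \<in> ball (\<gamma> t0) R" by eventually_elim auto
  then obtain d where d: "d > 0" "\<And>t. dist t t0 < d \<Longrightarrow> t \<in> I \<and> \<gamma> t \<in> ball (\<gamma> t0) R"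
    unfolding eventually_nhds_metric by blast
  let ?f = "\<lambda>t. w \<bullet> \<gamma> t"
  have "(?f has_vector_derivative w \<bullet> w) (at t0)"
    using w(1) unfolding has_vector_derivative_def
    by (auto intro!: derivative_eq_intros simp: inner_commute)
  then have f': "(?f has_real_derivative w \<bullet> w) (at t0)"
    by (simp add: has_real_derivative_iff_has_vector_derivative)
  have ww: "w \<bullet> w > 0" using w by simp
  obtain d1 where d1: "d1 > 0" "\<And>h. 0 < h \<Longrightarrow> h < d1 \<Longrightarrow> ?f t0 < ?f (t0 + h)"
    using has_real_derivative_pos_inc_right[OF f' ww] by auto
  obtain d2 where d2: "d2 > 0" "\<And>h. 0 < h \<Longrightarrow> h < d2 \<Longrightarrow> ?f (t0 - h) < ?f t0"
    using has_real_derivative_pos_inc_left[OF f' ww] by auto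
  \<comment> \<open>The values at \<open>t0 - h\<close> and \<open>t0 + h\<close> lie strictly on
    either side of that at \<open>t0\<close>, and the parameters in between stay in \<open>I\<close>
    with images in the ball.\<close>
  define h where "h = min d (min d1 d2) / 2"
  have h: "0 < h" "h < d" "h < d1" "h < d2" using d d1 d2 by (auto simp: h_def)
  have "((\<lambda>x. w \<bullet> x) \<longlongrightarrow> ?f t0) (nhds (\<gamma> t0))"
    by (intro tendsto_intros filterlim_ident)
  then have "\<forall>\<^sub>F x in nhds (\<gamma> t0). ?f (t0 - h) < w \<bullet> x" "\<forall>\<^sub>F x in nhds (\<gamma> t0). w \<bullet> x < ?f (t0 + h)"
    using d1(2)[OF h(1,3)] d2(2)[OF h(1,4)] order_tendstoD by blast+
  then show ?thesis
  proof eventually_elim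
    case (elim x)
    have "continuous_on {t0 - h..t0 + h} ?f"
      using \<gamma> d h by (intro continuous_intros continuous_on_subset[OF \<gamma>]) (auto simp: dist_real_def)
    then obtain t where t: "t0 - h \<le> t" "t \<le> t0 + h" "?f t = w \<bullet> x"
      using IVT'[of ?f "t0 - h" "w \<bullet> x" "t0 + h"] elim h by auto
    then have "dist t t0 < d" using h by (auto simp: dist_real_def)
    moreover have "w \<bullet> (x - \<gamma> t) = 0" using t(3) by (simp add: inner_diff_right)
    ultimately show ?case using d(2) by blast
  qed
qed

section \<open>Slice charts\<close>

lemma std_e1_eq: "std_e1 x = axis 1 1 + (x$2) *\<^sub>R axis 3 1"
  and std_e2_eq: "std_e2 x = axis 2 1 + (- x$1) *\<^sub>R axis 3 1"
  and std_T_eq: "std_T x = axis 3 1"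
  by (simp_all add: vec_eq_iff forall_3 std_e1_def std_e2_def std_T_def axis_def)

lemma std_e1_nth [simp]: "std_e1 x $ 1 = 1" "std_e1 x $ 2 = 0" "std_e1 x $ 3 = x$2"
  and std_e2_nth [simp]: "std_e2 x $ 1 = 0" "std_e2 x $ 2 = 1" "std_e2 x $ 3 = - x$1"
  and std_T_nth [simp]: "std_T x $ 1 = 0" "std_T x $ 2 = 0" "std_T x $ 3 = 1"
  by (simp_all add: std_e1_def std_e2_def std_T_def)

lemma smooth_on_std_e1: "open S \<Longrightarrow> smooth_on S std_e1"
  and smooth_on_std_e2: "open S \<Longrightarrow> smooth_on S std_e2"
  unfolding std_e1_eq[abs_def] std_e2_eq[abs_def]
  by (intro smooth_on_add smooth_on_const smooth_on_scaleR
      smooth_on_bounded_linear[OF smooth_on_ident] bounded_linear_minus bounded_linear_vec_nth; simp)+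

lemma horizontal_decomposition:
  "contact_form p v = 0 \<Longrightarrow> v = v$1 *\<^sub>R std_e1 p + v$2 *\<^sub>R std_e2 p"
  using frame_decomposition[of v p] by simp

lemma axis_nth_3 [simp]:
  "axis (1::3) (c::real) $ 2 = 0" "axis (1::3) c $ 3 = 0" "axis (2::3) c $ 1 = 0"
  "axis (2::3) c $ 3 = 0" "axis (3::3) c $ 1 = 0" "axis (3::3) c $ 2 = 0"
  by (simp_all add: axis_def)

section \<open>The defining function of a chart and its horizontal gradient\<close>

locale slice_chart =
  fixes \<Sigma> U V :: "(real^3) set" and \<phi> \<psi> :: "real^3 \<Rightarrow> real^3"
  assumes smooth_phi: "smooth_on U \<phi>" and smooth_psi: "smooth_on V \<psi>"
    and homeo: "homeomorphism U V \<phi> \<psi>" and slice: "\<Sigma> \<inter> U = {q \<in> U. \<phi> q $ 3 = 0}"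
begin

definition g :: "real^3 \<Rightarrow> real" where "g x = \<phi> x $ 3"

abbreviation "dg x \<equiv> frechet_derivative g (at x)"

definition g1 :: "real^3 \<Rightarrow> real" where "g1 x = dg x (std_e1 x)"
definition g2 :: "real^3 \<Rightarrow> real" where "g2 x = dg x (std_e2 x)"

lemma open_U: "open U" and open_V: "open V"
  using smooth_phi smooth_psi by (auto intro: smooth_on_open)

lemma smooth_g: "smooth_on U g"
  unfolding g_def[abs_def] by (rule smooth_on_bounded_linear[OF smooth_phi bounded_linear_vec_nth])

lemma smooth_g1: "smooth_on U g1" and smooth_g2: "smooth_on U g2"
  unfolding g1_def[abs_def] g2_def[abs_def]
  by (intro smooth_on_directional_derivative smooth_g smooth_on_std_e1 smooth_on_std_e2 open_U)+

lemma mem_surface_iff: "x \<in> U \<Longrightarrow> x \<in> \<Sigma> \<longleftrightarrow> g x = 0"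
  using slice by (auto simp: g_def)

lemma phi_V: "x \<in> U \<Longrightarrow> \<phi> x \<in> V" and psi_U: "y \<in> V \<Longrightarrow> \<psi> y \<in> U"
  and psi_phi: "x \<in> U \<Longrightarrow> \<psi> (\<phi> x) = x" and phi_psi: "y \<in> V \<Longrightarrow> \<phi> (\<psi> y) = y"
  using homeo by (auto simp: homeomorphism_def)

lemma dg_linear: "x \<in> U \<Longrightarrow> linear (dg x)"
  by (intro has_derivative_linear[OF smooth_on_has_derivative[OF smooth_g]])

lemma dg_phi: "x \<in> U \<Longrightarrow> dg x v = frechet_derivative \<phi> (at x) v $ 3"
  using frechet_derivative_at[OF bounded_linear.has_derivative[OF bounded_linear_vec_nth
        smooth_on_has_derivative[OF smooth_phi], of x 3]]
  by (simp add: g_def[abs_def] fun_eq_iff)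

text \<open>Since \<open>\<phi>\<close> and \<open>\<psi>\<close> are smooth and mutually inverse,
  so are their differentials. This identity gives curves pulled back from the chart a prescribed
  velocity; its counterpart \<open>derivative_phi_psi\<close> excludes critical points of
  \<open>g\<close>.\<close>

lemma derivative_psi_phi:
  assumes x: "x \<in> U"
  shows "frechet_derivative \<psi> (at (\<phi> x)) (frechet_derivative \<phi> (at x) v) = v"
proof -
  have "((\<lambda>x. \<psi> (\<phi> x)) has_derivative
      (\<lambda>v. frechet_derivative \<psi> (at (\<phi> x)) (frechet_derivative \<phi> (at x) v))) (at x)"
    by (rule has_derivative_compose[OF smooth_on_has_derivative[OF smooth_phi x]
          smooth_on_has_derivative[OF smooth_psi phi_V[OF x]]])
  moreover have "((\<lambda>x. \<psi> (\<phi> x)) has_derivative (\<lambda>v. v)) (at x)"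
    by (rule has_derivative_transform_within_open[OF has_derivative_ident open_U x]) (simp add: psi_phi)
  ultimately show ?thesis using has_derivative_unique by metis
qed

lemma derivative_phi_psi:
  assumes x: "x \<in> U"
  shows "frechet_derivative \<phi> (at x) (frechet_derivative \<psi> (at (\<phi> x)) v) = v"
proof -
  have "((\<lambda>y. \<phi> (\<psi> y)) has_derivative
      (\<lambda>v. frechet_derivative \<phi> (at (\<psi> (\<phi> x))) (frechet_derivative \<psi> (at (\<phi> x)) v))) (at (\<phi> x))"
    by (rule has_derivative_compose[OF smooth_on_has_derivative[OF smooth_psi phi_V[OF x]]
          smooth_on_has_derivative[OF smooth_phi]]) (simp add: psi_phi x)
  moreover have "((\<lambda>y. \<phi> (\<psi> y)) has_derivative (\<lambda>v. v)) (at (\<phi> x))"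
    by (rule has_derivative_transform_within_open[OF has_derivative_ident open_V phi_V[OF x]])
      (simp add: phi_psi)
  ultimately show ?thesis using has_derivative_unique x psi_phi by metis
qed

lemma dg_nonzero: "x \<in> U \<Longrightarrow> \<exists>v. dg x v \<noteq> 0"
  by (rule exI[of _ "frechet_derivative \<psi> (at (\<phi> x)) (axis 3 1)"])
    (simp add: dg_phi derivative_phi_psi)

text \<open>One inclusion differentiates \<open>g\<close> along a curve in the surface. For the
  other, a line in the chart whose direction has third component \<open>0\<close> stays in the
  slice, and \<open>\<psi>\<close> maps it to a curve in the surface with velocity
  \<open>v\<close>.\<close>

lemma tangent_plane_eq:
  assumes x: "x \<in> \<Sigma>" "x \<in> U"
  shows "tangent_plane \<Sigma> x = {v. dg x v = 0}"
proof (intro set_eqI iffI CollectI; (elim CollectE)?)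
  fix v assume "v \<in> tangent_plane \<Sigma> x"
  then obtain \<epsilon> c where c: "\<epsilon> > 0" "c ` {-\<epsilon><..<\<epsilon>} \<subseteq> \<Sigma>" "c 0 = x" "(c has_vector_derivative v) (at 0)"
    unfolding tangent_plane_def by blast
  have 1: "((\<lambda>s. g (c s)) has_derivative (\<lambda>h. dg x (h *\<^sub>R v))) (at 0)"
    using has_derivative_compose[OF c(4)[unfolded has_vector_derivative_def], of g "dg x"]
      smooth_on_has_derivative[OF smooth_g x(2)] c(3) by simp
  have "\<forall>\<^sub>F s in at 0. c s \<in> U"
    using has_vector_derivative_continuous[OF c(4)] open_U x c(3)
    by (auto simp: isCont_def intro: topological_tendstoD)
  moreover have "\<forall>\<^sub>F s in at 0. s \<in> {-\<epsilon><..<\<epsilon>}"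
    using c(1) by (intro eventually_at_in_open') auto
  ultimately have "\<forall>\<^sub>F s in at 0. g (c s) = 0"
    by eventually_elim (use c(2) mem_surface_iff in blast)
  then have "((\<lambda>s. g (c s)) has_derivative (\<lambda>h. 0)) (at 0)"
    using x c(3) mem_surface_iff
    by (intro has_derivative_transform_eventually[OF has_derivative_const]) (auto elim: eventually_mono)
  from has_derivative_unique[OF 1 this] have "dg x (1 *\<^sub>R v) = 0" by metis
  then show "dg x v = 0" by simp
next
  fix v assume v: "dg x v = 0"
  define w where "w = frechet_derivative \<phi> (at x) v"
  have w3: "w $ 3 = 0" using v dg_phi[OF x(2)] by (simp add: w_def)
  obtain r where r: "r > 0" "ball (\<phi> x) r \<subseteq> V"
    using open_V phi_V[OF x(2)] open_contains_ball by blast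
  define \<epsilon> where "\<epsilon> = r / (norm w + 1)"
  have \<epsilon>: "\<epsilon> > 0" using r by (simp add: \<epsilon>_def add_nonneg_pos)
  have inV: "\<phi> x + t *\<^sub>R w \<in> V" if "t \<in> {-\<epsilon><..<\<epsilon>}" for t
  proof -
    have "norm (t *\<^sub>R w) \<le> \<bar>t\<bar> * (norm w + 1)" by (simp add: algebra_simps)
    also have "\<dots> < r" using that by (auto simp: \<epsilon>_def pos_less_divide_eq[symmetric] add_nonneg_pos abs_if)
    finally show ?thesis using r by (auto simp: dist_norm)
  qed
  define c where "c t = \<psi> (\<phi> x + t *\<^sub>R w)" for t
  have "smooth_on {-\<epsilon><..<\<epsilon>} c"
    unfolding smooth_on_def c_def
    by (intro conjI allI Ck_on_compose_line[OF open_V _ inV] smooth_on_Ck[OF smooth_psi]) auto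
  moreover have "c ` {-\<epsilon><..<\<epsilon>} \<subseteq> \<Sigma>"
  proof clarify
    fix t assume "t \<in> {-\<epsilon><..<\<epsilon>}"
    then have t: "\<phi> x + t *\<^sub>R w \<in> V" by (rule inV)
    have "g x = 0" using x mem_surface_iff by blast
    then show "c t \<in> \<Sigma>"
      using mem_surface_iff[OF psi_U[OF t]] phi_psi[OF t] w3 by (simp add: g_def c_def)
  qed
  moreover have "c 0 = x" by (simp add: c_def psi_phi x)
  moreover have "(c has_vector_derivative v) (at 0)"
  proof -
    have 1: "((\<lambda>t. \<phi> x + t *\<^sub>R w) has_derivative (\<lambda>h. h *\<^sub>R w)) (at 0)"
      by (auto intro!: derivative_eq_intros)
    have "linear (frechet_derivative \<psi> (at (\<phi> x)))"
      by (intro has_derivative_linear[OF smooth_on_has_derivative[OF smooth_psi phi_V[OF x(2)]]])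
    then show ?thesis
      using has_derivative_compose[OF 1, of \<psi> "frechet_derivative \<psi> (at (\<phi> x))"]
        smooth_on_has_derivative[OF smooth_psi phi_V[OF x(2)]] derivative_psi_phi[OF x(2)]
      by (simp add: c_def[abs_def] has_vector_derivative_def linear_scale w_def)
  qed
  ultimately show "v \<in> tangent_plane \<Sigma> x"
    unfolding tangent_plane_def using \<epsilon> by blast
qed

lemma dg_frame:
  "x \<in> U \<Longrightarrow> dg x v = v$1 * g1 x + v$2 * g2 x + contact_form x v * dg x (axis 3 1)"
  using arg_cong[OF frame_decomposition[of v x], of "dg x"] dg_linear[of x]
  by (simp add: linear_add linear_scale std_T_eq g1_def g2_def)

text \<open>In the frame, \<open>dg x\<close> has the components \<open>g1 x\<close>,
  \<open>g2 x\<close> and \<open>dg x (axis 3 1)\<close>. If the first two vanish, the third cannot,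
  as \<open>g\<close> has no critical points, and \<open>dg x\<close> is a nonzero multiple of the
  contact form.\<close>

lemma singular_iff:
  assumes x: "x \<in> \<Sigma>" "x \<in> U"
  shows "x \<in> singular_set \<Sigma> \<longleftrightarrow> g1 x = 0 \<and> g2 x = 0"
proof
  assume "x \<in> singular_set \<Sigma>"
  then have *: "{v. dg x v = 0} = {v. contact_form x v = 0}"
    using tangent_plane_eq[OF x] by (auto simp: singular_set_def contact_plane_def)
  have "contact_form x (std_e1 x) = 0" "contact_form x (std_e2 x) = 0"
    by (simp_all add: contact_form_def)
  with * show "g1 x = 0 \<and> g2 x = 0" by (auto simp: g1_def g2_def)
next
  assume g: "g1 x = 0 \<and> g2 x = 0"
  obtain v where "dg x v \<noteq> 0" using dg_nonzero[OF x(2)] by blast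
  then have T: "dg x (axis 3 1) \<noteq> 0" using g dg_frame[OF x(2), of v] by auto
  have "dg x v = 0 \<longleftrightarrow> contact_form x v = 0" for v
    using g T dg_frame[OF x(2), of v] by simp
  then show "x \<in> singular_set \<Sigma>"
    using x by (simp add: singular_set_def contact_plane_def tangent_plane_eq)
qed

section \<open>An explicit unit characteristic field\<close>

text \<open>Reciprocal length of the horizontal gradient, with the default value \<open>0\<close>
  where that gradient vanishes, by the convention for \<open>0 powr r\<close>.\<close>

definition inv_grad_norm :: "real^3 \<Rightarrow> real" where
  "inv_grad_norm x = ((g1 x)\<^sup>2 + (g2 x)\<^sup>2) powr (- 1/2)"

text \<open>The horizontal gradient, normalised and turned by a right angle, with
  \<open>\<sigma>\<close> as orientation. It is tangent to every level set of \<open>g\<close> in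
  \<open>U\<close>, which gives control off the surface as well.\<close>

definition char_vf :: "real \<Rightarrow> real^3 \<Rightarrow> real^3" where
  "char_vf \<sigma> x = (\<sigma> * inv_grad_norm x * g2 x) *\<^sub>R std_e1 x + (- \<sigma> * inv_grad_norm x * g1 x) *\<^sub>R std_e2 x"

lemma inv_grad_norm_square:
  assumes "(g1 x)\<^sup>2 + (g2 x)\<^sup>2 \<noteq> 0"
  shows "(inv_grad_norm x)\<^sup>2 * ((g1 x)\<^sup>2 + (g2 x)\<^sup>2) = 1"
proof -
  have "(g1 x)\<^sup>2 + (g2 x)\<^sup>2 > 0" using assms by (smt (verit) zero_le_power2)
  then show ?thesis
    by (simp add: inv_grad_norm_def powr_minus powr_half_sqrt power_inverse del: sum_power2_eq_zero_iff)
qed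

lemma char_vf_nth [simp]:
  "char_vf \<sigma> x $ 1 = \<sigma> * inv_grad_norm x * g2 x" "char_vf \<sigma> x $ 2 = - \<sigma> * inv_grad_norm x * g1 x"
  by (simp_all add: char_vf_def)

lemma contact_form_char_vf [simp]: "contact_form x (char_vf \<sigma> x) = 0"
  by (simp add: contact_form_def char_vf_def algebra_simps)

lemma dg_char_vf: "x \<in> U \<Longrightarrow> dg x (char_vf \<sigma> x) = 0"
  by (simp add: dg_frame[of x "char_vf \<sigma> x"])

lemma char_field_char_vf:
  assumes B: "open B" "B \<subseteq> U" "\<And>x. x \<in> B \<Longrightarrow> (g1 x)\<^sup>2 + (g2 x)\<^sup>2 \<noteq> 0" and \<sigma>: "\<sigma>\<^sup>2 = 1"
  shows "char_field \<Sigma> B (char_vf \<sigma>)"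
  unfolding char_field_def
proof (intro conjI ballI)
  have s: "smooth_on B g1" "smooth_on B g2"
    using smooth_g1 smooth_g2 smooth_on_subset B by blast+
  have "smooth_on B inv_grad_norm"
    unfolding inv_grad_norm_def[abs_def] power2_eq_square
    by (intro smooth_on_powr smooth_on_add smooth_on_mult s)
      (use B(3) in \<open>metis not_real_square_gt_zero power2_eq_square sum_power2_gt_zero_iff sum_power2_eq_zero_iff\<close>)
  then show "smooth_on B (char_vf \<sigma>)"
    unfolding char_vf_def[abs_def]
    by (intro smooth_on_add smooth_on_scaleR smooth_on_mult smooth_on_std_e1 smooth_on_std_e2
        smooth_on_const s B(1))
  show "\<Sigma> \<inter> B \<subseteq> regular_part \<Sigma>"
    using B singular_iff by (fastforce simp: regular_part_def)
next
  fix x assume x: "x \<in> \<Sigma> \<inter> B"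
  then show "char_vf \<sigma> x \<in> tangent_plane \<Sigma> x \<inter> contact_plane x"
    using B tangent_plane_eq dg_char_vf by (auto simp: contact_plane_def)
  have "adapted_metric x (char_vf \<sigma> x) (char_vf \<sigma> x) = \<sigma>\<^sup>2 * ((inv_grad_norm x)\<^sup>2 * ((g1 x)\<^sup>2 + (g2 x)\<^sup>2))"
    by (simp add: adapted_metric_def power2_eq_square algebra_simps)
  then show "adapted_metric x (char_vf \<sigma> x) (char_vf \<sigma> x) = 1"
    using inv_grad_norm_square B(3) x \<sigma> by simp
qed

text \<open>A point \<open>x\<close> is compared with its projection to the surface along the third
  chart coordinate. The projection moves \<open>x\<close> by at most a multiple of
  \<open>\<bar>g x\<bar>\<close>, and \<open>F\<close> is Lipschitz and zero at the projected
  point.\<close>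

lemma vanishing_on_surface_le:
  fixes F :: "real^3 \<Rightarrow> 'b::real_normed_vector"
  assumes F: "smooth_on B F" and B: "B \<subseteq> U" and q: "q \<in> B" "q \<in> \<Sigma>"
    and F0: "\<And>x. x \<in> \<Sigma> \<inter> B \<Longrightarrow> F x = 0"
  obtains r C where "r > 0" "C > 0" "\<And>x. x \<in> ball q r \<Longrightarrow> norm (F x) \<le> C * \<bar>g x\<bar>"
proof -
  have qU: "q \<in> U" using q B by auto
  obtain r1 L1 where r1: "r1 > 0" "L1 > 0" "ball q r1 \<subseteq> B"
    "\<And>x y. x \<in> ball q r1 \<Longrightarrow> y \<in> ball q r1 \<Longrightarrow> norm (F y - F x) \<le> L1 * norm (y - x)"
    using smooth_on_Lipschitz[OF F q(1)] by blast
  obtain r2 L2 where r2: "r2 > 0" "L2 > 0" "ball (\<phi> q) r2 \<subseteq> V"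
    "\<And>x y. x \<in> ball (\<phi> q) r2 \<Longrightarrow> y \<in> ball (\<phi> q) r2 \<Longrightarrow> norm (\<psi> y - \<psi> x) \<le> L2 * norm (y - x)"
    using smooth_on_Lipschitz[OF smooth_psi phi_V[OF qU]] by blast
  \<comment> \<open>Sets the third chart coordinate to zero, so that \<open>\<psi> (P x)\<close> is
    the projected point.\<close>
  define P where "P x = \<phi> x - g x *\<^sub>R axis 3 1" for x
  have Pq: "P q = \<phi> q" using mem_surface_iff[OF qU] q by (simp add: P_def)
  have cP: "continuous (at q) P"
    unfolding P_def[abs_def]
    by (intro continuous_intros smooth_on_continuous[OF smooth_phi qU] smooth_on_continuous[OF smooth_g qU])
  have cpsi: "continuous (at (P q)) \<psi>"
    unfolding Pq by (rule smooth_on_continuous[OF smooth_psi phi_V[OF qU]])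
  have c2: "continuous (at q) (\<lambda>x. \<psi> (P x))"
    using isCont_o2[OF cP cpsi] .
  have "\<forall>\<^sub>F x in nhds q. x \<in> ball q r1" using r1 by (intro eventually_nhds_in_open) auto
  moreover have "\<forall>\<^sub>F x in nhds q. \<phi> x \<in> ball (\<phi> q) r2"
    by (rule isCont_eventually_nhds[OF smooth_on_continuous[OF smooth_phi qU]]) (use r2(1) in auto)
  moreover have "\<forall>\<^sub>F x in nhds q. P x \<in> ball (\<phi> q) r2"
    by (rule isCont_eventually_nhds[OF cP]) (use r2(1) Pq in auto)
  moreover have "\<forall>\<^sub>F x in nhds q. \<psi> (P x) \<in> ball q r1"
    by (rule isCont_eventually_nhds[OF c2]) (use r1(1) Pq psi_phi[OF qU] in auto)
  ultimately have "\<forall>\<^sub>F x in nhds q. norm (F x) \<le> (L1 * L2) * \<bar>g x\<bar>"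
  proof eventually_elim
    case (elim x)
    have xU: "x \<in> U" using elim(1) r1(3) B by auto
    have PV: "P x \<in> V" using elim(3) r2 by auto
    have "g (\<psi> (P x)) = 0" using phi_psi[OF PV] by (simp add: g_def P_def axis_def)
    then have "F (\<psi> (P x)) = 0"
      using F0 elim(4) r1(3) B mem_surface_iff[OF psi_U[OF PV]] by blast
    then have "norm (F x) \<le> L1 * norm (x - \<psi> (P x))"
      using r1(4)[OF elim(4,1)] by simp
    also have "x - \<psi> (P x) = \<psi> (\<phi> x) - \<psi> (P x)" using psi_phi[OF xU] by simp
    also have "L1 * norm (\<psi> (\<phi> x) - \<psi> (P x)) \<le> L1 * (L2 * norm (\<phi> x - P x))"
      using r1(2) r2(4)[OF elim(3,2)] by simp
    also have "\<phi> x - P x = g x *\<^sub>R axis 3 1" by (simp add: P_def)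
    finally show ?case by (simp add: norm_axis_1 mult.assoc)
  qed
  then obtain r where "r > 0" "\<And>x. dist x q < r \<Longrightarrow> norm (F x) \<le> (L1 * L2) * \<bar>g x\<bar>"
    unfolding eventually_nhds_metric by blast
  with r1(2) r2(2) show thesis by (intro that[of r "L1 * L2"]) (auto simp: dist_commute)
qed

end

lemma smooth_surface_chart:
  assumes "smooth_surface \<Sigma>" "p \<in> \<Sigma>"
  obtains U V \<phi> \<psi> where "slice_chart \<Sigma> U V \<phi> \<psi>" "p \<in> U"
proof -
  from assms(1)[unfolded smooth_surface_def, rule_format, OF assms(2)]
  obtain U V and \<phi> \<psi> :: "real^3 \<Rightarrow> real^3" where
    "p \<in> U" "smooth_on U \<phi>" "smooth_on V \<psi>" "homeomorphism U V \<phi> \<psi>"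
    "\<Sigma> \<inter> U = {q \<in> U. \<phi> q $ 3 = 0}"
    by (elim exE conjE)
  then show thesis by (intro that[of U V \<phi> \<psi>] slice_chart.intro)
qed

text \<open>In the frame \<open>J\<close> swaps the two horizontal components up to sign, so zero
  curvature makes both constant to first order along \<open>e\<close>. The third coordinate is
  determined by these two and the base point through horizontality, and its derivative
  cancels.\<close>

lemma char_field_parallel:
  assumes min: "p_minimal_surface \<Sigma>" and e: "char_field \<Sigma> B e" and p: "p \<in> \<Sigma>" "p \<in> B"
  shows "frechet_derivative e (at p) (e p) = 0"
proof -
  have es: "smooth_on B e" using e by (simp add: char_field_def)
  let ?D = "frechet_derivative e (at p)"
  have hd: "(e has_derivative ?D) (at p)" by (rule smooth_on_has_derivative[OF es p(2)])
  have comp: "((\<lambda>q. e q $ i) has_derivative (\<lambda>v. ?D v $ i)) (at p)" for i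
    by (rule bounded_linear.has_derivative[OF bounded_linear_vec_nth hd])
  have "has_p_mean_curvature e p 0"
    using min e p by (auto simp: p_minimal_surface_def)
  then have n: "nabla p (e p) (\<lambda>q. contact_J q (e q)) = 0"
    by (simp add: has_p_mean_curvature_def)
  have D2: "?D (e p) $ 2 = 0"
  proof -
    have "nabla p (e p) (\<lambda>q. contact_J q (e q)) $ 1 = frechet_derivative (\<lambda>q. - e q $ 2) (at p) (e p)"
      by (simp add: nabla_def contact_J_def)
    also have "\<dots> = - ?D (e p) $ 2"
      using frechet_derivative_at[OF has_derivative_minus[OF comp[of 2]]] by (metis)
    finally show ?thesis using n by simp
  qed
  have D1: "?D (e p) $ 1 = 0"
  proof -
    have "nabla p (e p) (\<lambda>q. contact_J q (e q)) $ 2 = frechet_derivative (\<lambda>q. e q $ 1) (at p) (e p)"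
      by (simp add: nabla_def contact_J_def)
    also have "\<dots> = ?D (e p) $ 1"
      using frechet_derivative_at[OF comp[of 1]] by metis
    finally show ?thesis using n by simp
  qed
  have hor: "e x $ 3 = x$2 * e x $ 1 - x$1 * e x $ 2" if "x \<in> \<Sigma> \<inter> B" for x
    using e that by (auto simp: char_field_def contact_plane_def contact_form_def) (smt (verit) IntI)
  \<comment> \<open>Horizontality of \<open>e\<close> is known only on the surface, so the third
    coordinate is differentiated along a curve in the surface.\<close>
  have "e p \<in> tangent_plane \<Sigma> p" using e p by (auto simp: char_field_def)
  then obtain \<epsilon> c where c: "\<epsilon> > 0" "c ` {-\<epsilon><..<\<epsilon>} \<subseteq> \<Sigma>" "c 0 = p" "(c has_vector_derivative e p) (at 0)"
    unfolding tangent_plane_def by blast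
  have dc: "(c has_derivative (\<lambda>h. h *\<^sub>R e p)) (at 0)"
    using c(4) by (simp add: has_vector_derivative_def)
  have "linear ?D" by (rule has_derivative_linear[OF hd])
  then have dec: "((\<lambda>s. e (c s) $ i) has_derivative (\<lambda>h. h * ?D (e p) $ i)) (at 0)" for i
    using has_derivative_compose[OF dc comp[of i, folded c(3)]] c(3) by (simp add: linear_scale)
  have dci: "((\<lambda>s. c s $ i) has_derivative (\<lambda>h. h * e p $ i)) (at 0)" for i
    using bounded_linear.has_derivative[OF bounded_linear_vec_nth dc, of i] by simp
  have "((\<lambda>s. c s $ 2 * e (c s) $ 1 - c s $ 1 * e (c s) $ 2) has_derivative
      (\<lambda>h. (c 0 $ 2 * (h * ?D (e p) $ 1) + h * e p $ 2 * e (c 0) $ 1) -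
        (c 0 $ 1 * (h * ?D (e p) $ 2) + h * e p $ 1 * e (c 0) $ 2))) (at 0)"
    by (intro has_derivative_diff has_derivative_mult dec dci)
  \<comment> \<open>The derivatives of the components vanish by \<open>D1\<close> and
    \<open>D2\<close>; what the moving base point contributes is the difference of two equal
    products of components of \<open>e p\<close>.\<close>
  then have 1: "((\<lambda>s. c s $ 2 * e (c s) $ 1 - c s $ 1 * e (c s) $ 2) has_derivative (\<lambda>h. 0)) (at 0)"
    by (simp add: D1 D2 c(3) mult.commute)
  have "open B" "p \<in> B" using smooth_on_open[OF es] p by auto
  then have "\<forall>\<^sub>F s in at 0. c s \<in> B"
    using has_vector_derivative_continuous[OF c(4)] c(3)
    by (auto simp: isCont_def intro: topological_tendstoD)
  moreover have "\<forall>\<^sub>F s in at 0. s \<in> {-\<epsilon><..<\<epsilon>}"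
    using c(1) by (intro eventually_at_in_open') auto
  ultimately have "\<forall>\<^sub>F s in at 0. c s $ 2 * e (c s) $ 1 - c s $ 1 * e (c s) $ 2 = e (c s) $ 3"
    by eventually_elim (use c(2) hor in force)
  from has_derivative_transform_eventually[OF 1 this]
  have "((\<lambda>s. e (c s) $ 3) has_derivative (\<lambda>h. 0)) (at 0)"
    using hor p c(3) by simp
  from has_derivative_unique[OF this dec[of 3]] have "?D (e p) $ 3 = 0"
    by (metis mult_1)
  with D1 D2 show ?thesis by (simp add: vec_eq_iff forall_3)
qed

section \<open>Characteristic curves are lines\<close>

text \<open>By \<open>char_field_parallel\<close> the velocity has zero derivative, hence is
  constant on the interval.\<close>

lemma char_curve_line:
  assumes min: "p_minimal_surface \<Sigma>" and c: "char_curve \<Sigma> I c"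
  obtains P u where "\<And>t. t \<in> I \<Longrightarrow> c t = P + t *\<^sub>R u" "(u$1)\<^sup>2 + (u$2)\<^sup>2 = 1"
    "\<And>t. t \<in> I \<Longrightarrow> c t \<in> regular_part \<Sigma> \<and> u \<in> tangent_plane \<Sigma> (c t) \<and> contact_form (c t) u = 0"
proof -
  have I: "open I" "convex I" "I \<noteq> {}"
    using c by (auto simp: char_curve_def is_interval_convex)
  \<comment> \<open>The local fields may differ in sign from one parameter to another;
    \<open>D\<close> is defined on all of \<open>I\<close> and agrees with each of them
    locally.\<close>
  define D where "D s = vector_derivative c (at s)" for s
  have loc: "(c has_vector_derivative D t) (at t) \<and> (D has_vector_derivative 0) (at t) \<and>
      c t \<in> regular_part \<Sigma> \<and> D t \<in> tangent_plane \<Sigma> (c t) \<and> contact_form (c t) (D t) = 0 \<and>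
      (D t $ 1)\<^sup>2 + (D t $ 2)\<^sup>2 = 1" if t: "t \<in> I" for t
  proof -
    obtain B e where e: "char_field \<Sigma> B e"
      and ev: "\<forall>\<^sub>F s in nhds t. c s \<in> \<Sigma> \<inter> B \<and> (c has_vector_derivative e (c s)) (at s)"
      using c t unfolding char_curve_def by blast
    have at: "c t \<in> \<Sigma> \<inter> B" "(c has_vector_derivative e (c t)) (at t)"
      using eventually_nhds_x_imp_x[OF ev] by auto
    have Dt: "D t = e (c t)" using vector_derivative_at[OF at(2)] by (simp add: D_def)
    have "(e has_derivative frechet_derivative e (at (c t))) (at (c t))"
      using e at by (auto simp: char_field_def intro: smooth_on_has_derivative)
    from has_derivative_compose[OF at(2)[unfolded has_vector_derivative_def] this]
    have "((\<lambda>s. e (c s)) has_derivative (\<lambda>h. frechet_derivative e (at (c t)) (h *\<^sub>R e (c t)))) (at t)" .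
    moreover have "linear (frechet_derivative e (at (c t)))"
      by (rule has_derivative_linear) fact
    ultimately have "((\<lambda>s. e (c s)) has_vector_derivative 0) (at t)"
      using char_field_parallel[OF min e] at by (simp add: has_vector_derivative_def linear_scale)
    moreover have "\<forall>\<^sub>F s in nhds t. e (c s) = D s"
      using ev by eventually_elim (auto simp: D_def dest: vector_derivative_at)
    ultimately have "(D has_vector_derivative 0) (at t)"
      unfolding has_vector_derivative_def
      using has_derivative_transform_eventually[of "\<lambda>s. e (c s)" _ t UNIV D] Dt
      by (simp add: eventually_at_filter eventually_mono)
    moreover have "contact_form (c t) (e (c t)) = 0"
      "adapted_metric (c t) (e (c t)) (e (c t)) = 1" "e (c t) \<in> tangent_plane \<Sigma> (c t)"
      "c t \<in> regular_part \<Sigma>"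
      using e at by (auto simp: char_field_def contact_plane_def)
    ultimately show ?thesis using at(2) Dt by (simp add: adapted_metric_def power2_eq_square)
  qed
  obtain u where u: "\<And>t. t \<in> I \<Longrightarrow> D t = u"
    using has_vector_derivative_zero_constant[OF I(2), of D] loc has_vector_derivative_at_within by metis
  have "((\<lambda>t. c t - t *\<^sub>R u) has_vector_derivative 0) (at t within I)" if "t \<in> I" for t
    using loc[OF that] u[OF that]
    by (auto intro!: derivative_eq_intros intro: has_vector_derivative_at_within)
  then obtain P where "\<And>t. t \<in> I \<Longrightarrow> c t - t *\<^sub>R u = P"
    using has_vector_derivative_zero_constant[OF I(2), of "\<lambda>t. c t - t *\<^sub>R u"] by metis
  then have "c t = P + t *\<^sub>R u" if "t \<in> I" for t using that by (metis diff_add_cancel)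
  moreover obtain t0 where "t0 \<in> I" using I(3) by blast
  ultimately show thesis using that loc u by metis
qed

section \<open>Continuation of characteristic lines\<close>

text \<open>The form depends on the base point through an antisymmetric expression, to which a
  displacement along \<open>u\<close> itself contributes nothing. So a line horizontal at one point
  is horizontal throughout.\<close>

lemma contact_form_translate [simp]: "contact_form (x + s *\<^sub>R u) u = contact_form x u"
  by (simp add: contact_form_def algebra_simps)

lemma line_in_ball:
  fixes u :: "'a::real_normed_vector"
  assumes "\<bar>s\<bar> < r / (norm u + 1)"
  shows "q + s *\<^sub>R u \<in> ball q r"
proof -
  have "norm (s *\<^sub>R u) \<le> \<bar>s\<bar> * (norm u + 1)" by (simp add: algebra_simps)
  also have "\<dots> < r" using assms by (simp add: pos_less_divide_eq add_nonneg_pos)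
  finally show ?thesis by (simp add: dist_norm)
qed

context slice_chart
begin

text \<open>The line is compared with an explicit characteristic field \<open>e\<close> normalised
  by \<open>e q = u\<close>. A Gronwall estimate for the defects \<open>e - u\<close> and
  \<open>g\<close> along the line shows that near \<open>q\<close> it neither leaves the surface nor
  deviates from \<open>e\<close>.\<close>

lemma char_line_extends:
  assumes min: "p_minimal_surface \<Sigma>" and q: "q \<in> \<Sigma>" "q \<in> U" "q \<in> regular_part \<Sigma>"
    and hor: "contact_form q u = 0" and unit: "(u$1)\<^sup>2 + (u$2)\<^sup>2 = 1" and tan: "dg q u = 0"
  obtains B e \<delta> where "\<delta> > 0" "char_field \<Sigma> B e"
    "\<And>s. \<bar>s\<bar> < \<delta> \<Longrightarrow> q + s *\<^sub>R u \<in> \<Sigma> \<inter> B \<and> e (q + s *\<^sub>R u) = u"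
proof -
  let ?n = "\<lambda>x. (g1 x)\<^sup>2 + (g2 x)\<^sup>2"
  define B where "B = {x \<in> U. ?n x \<noteq> 0}"
  have "continuous_on U ?n"
    by (intro continuous_at_imp_continuous_on ballI continuous_intros
        smooth_on_continuous[OF smooth_g1] smooth_on_continuous[OF smooth_g2])
  then have "open (U \<inter> ?n -` (- {0}))"
    by (intro continuous_open_preimage open_U) auto
  moreover have "B = U \<inter> ?n -` (- {0})" by (auto simp: B_def)
  ultimately have B: "open B" "B \<subseteq> U" "\<And>x. x \<in> B \<Longrightarrow> ?n x \<noteq> 0" by (auto simp: B_def)
  have qB: "q \<in> B"
    using q singular_iff[OF q(1,2)] by (auto simp: B_def regular_part_def)
  \<comment> \<open>Inner product of \<open>u\<close> with the turned unit gradient. As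
    \<open>u\<close> is a unit vector perpendicular to the gradient, this is a sign, and it selects
    the orientation with \<open>e q = u\<close>.\<close>
  define \<sigma> where "\<sigma> = inv_grad_norm q * (u$1 * g2 q - u$2 * g1 q)"
  have perp: "u$1 * g1 q + u$2 * g2 q = 0" using tan hor dg_frame[OF q(2), of u] by simp
  have N: "(inv_grad_norm q)\<^sup>2 * ?n q = 1" by (rule inv_grad_norm_square[OF B(3)[OF qB]])
  have "\<sigma>\<^sup>2 = (inv_grad_norm q)\<^sup>2 * (((u$1)\<^sup>2 + (u$2)\<^sup>2) * ?n q - (u$1 * g1 q + u$2 * g2 q)\<^sup>2)"
    unfolding \<sigma>_def by algebra
  then have \<sigma>: "\<sigma>\<^sup>2 = 1" using N unit perp by simp
  define e where "e = char_vf \<sigma>"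
  have cf: "char_field \<Sigma> B e" unfolding e_def by (rule char_field_char_vf[OF B \<sigma>])
  then have es: "smooth_on B e" by (simp add: char_field_def)
  have eq: "e q = u"
  proof -
    have 1: "e q $ 1 = u $ 1"
    proof -
      have "e q $ 1 = (inv_grad_norm q)\<^sup>2 * (u$1 * ?n q - g1 q * (u$1 * g1 q + u$2 * g2 q))"
        by (simp add: e_def \<sigma>_def) algebra
      also have "\<dots> = u$1 * ((inv_grad_norm q)\<^sup>2 * ?n q)" using perp by simp
      finally show ?thesis using N by simp
    qed
    have 2: "e q $ 2 = u $ 2"
    proof -
      have "e q $ 2 = (inv_grad_norm q)\<^sup>2 * (u$2 * ?n q - g2 q * (u$1 * g1 q + u$2 * g2 q))"
        by (simp add: e_def \<sigma>_def) algebra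
      also have "\<dots> = u$2 * ((inv_grad_norm q)\<^sup>2 * ?n q)" using perp by simp
      finally show ?thesis using N by simp
    qed
    have "contact_form q (e q) = 0" by (simp add: e_def)
    then have "e q = e q $ 1 *\<^sub>R std_e1 q + e q $ 2 *\<^sub>R std_e2 q" by (rule horizontal_decomposition)
    then show ?thesis using horizontal_decomposition[OF hor] 1 2 by simp
  qed
  \<comment> \<open>The derivative of \<open>e\<close> along itself is zero on the surface by
    p-minimality, so near \<open>q\<close> it is bounded by a multiple of
    \<open>\<bar>g\<bar>\<close>.\<close>
  define W where "W x = frechet_derivative e (at x) (e x)" for x
  have Ws: "smooth_on B W" unfolding W_def[abs_def] by (rule smooth_on_directional_derivative[OF es es])
  have W0: "W x = 0" if "x \<in> \<Sigma> \<inter> B" for x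
    using char_field_parallel[OF min cf] that by (simp add: W_def)
  obtain r1 C where r1: "r1 > 0" "C > 0" "\<And>x. x \<in> ball q r1 \<Longrightarrow> norm (W x) \<le> C * \<bar>g x\<bar>"
    using vanishing_on_surface_le[OF Ws B(2) qB q(1) W0] by metis
  obtain r2 M where r2: "r2 > 0" "M > 0" "ball q r2 \<subseteq> B"
    "\<And>x v. x \<in> ball q r2 \<Longrightarrow> norm (frechet_derivative e (at x) v) \<le> M * norm v"
    using smooth_on_derivative_bounded[OF es qB] by metis
  obtain r3 M' where r3: "r3 > 0" "M' > 0"
    "\<And>x v. x \<in> ball q r3 \<Longrightarrow> norm (dg x v) \<le> M' * norm v"
    using smooth_on_derivative_bounded[OF smooth_g q(2)] by metis
  define r where "r = min r1 (min r2 r3)"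
  define \<delta> where "\<delta> = r / (norm u + 1)"
  have \<delta>: "\<delta> > 0" using r1 r2 r3 by (simp add: \<delta>_def r_def add_nonneg_pos)
  define L where "L s = q + s *\<^sub>R u" for s
  \<comment> \<open>\<open>Y\<close> measures how far the line is from being a leaf. It satisfies \<open>|Y'| \<le> K |Y|\<close> because
    \<open>W\<close> vanishes on the surface, hence is bounded by a multiple of \<open>|g|\<close> near it.\<close>
  define Y where "Y s = (e (L s) - u, g (L s))" for s
  define Y' where "Y' s = (frechet_derivative e (at (L s)) u, dg (L s) u)" for s
  have LB: "L s \<in> ball q r" if "\<bar>s\<bar> < \<delta>" for s
    using line_in_ball[of s r u q] that by (simp add: L_def \<delta>_def)
  have Y0: "Y s = 0" if s: "\<bar>s\<bar> < \<delta>" for s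
  proof (rule vanishing_of_differential_inequality[OF _ _ _ s])
    fix s assume s: "\<bar>s\<bar> < \<delta>"
    have LsB: "L s \<in> B" using LB[OF s] r2(3) by (auto simp: r_def)
    then have LsU: "L s \<in> U" using B by auto
    have hL: "(L has_derivative (\<lambda>h. h *\<^sub>R u)) (at s)"
      unfolding L_def[abs_def] by (auto intro!: derivative_eq_intros)
    have line: "linear (frechet_derivative e (at (L s)))"
      by (rule has_derivative_linear[OF smooth_on_has_derivative[OF es LsB]])
    have "((\<lambda>s. e (L s)) has_derivative (\<lambda>h. h *\<^sub>R frechet_derivative e (at (L s)) u)) (at s)"
      using has_derivative_compose[OF hL smooth_on_has_derivative[OF es LsB]] line
      by (simp add: linear_scale)
    moreover have "((\<lambda>s. g (L s)) has_derivative (\<lambda>h. h *\<^sub>R dg (L s) u)) (at s)"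
      using has_derivative_compose[OF hL smooth_on_has_derivative[OF smooth_g LsU]] dg_linear[OF LsU]
      by (simp add: linear_scale)
    ultimately show "(Y has_vector_derivative Y' s) (at s)"
      unfolding Y_def[abs_def] Y'_def has_vector_derivative_def
      by (auto intro!: derivative_eq_intros)
    let ?f = "e (L s) - u"
    \<comment> \<open>Replacing \<open>u\<close> by \<open>e (L s)\<close> costs only a derivative
      in the direction of the defect \<open>?f\<close>.\<close>
    have "frechet_derivative e (at (L s)) u = W (L s) - frechet_derivative e (at (L s)) ?f"
      using line by (simp add: W_def linear_diff)
    then have "norm (frechet_derivative e (at (L s)) u) \<le> C * \<bar>g (L s)\<bar> + M * norm ?f"
      using norm_triangle_ineq4[of "W (L s)" "frechet_derivative e (at (L s)) ?f"]
        r1(3)[of "L s"] r2(4)[of "L s" ?f] LB[OF s] by (simp add: r_def)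
    \<comment> \<open>The field \<open>e\<close> annihilates \<open>g\<close> off the surface too,
      so only the defect contributes.\<close>
    moreover have "dg (L s) u = - dg (L s) ?f"
      using dg_linear[OF LsU] dg_char_vf[OF LsU, of \<sigma>] by (simp add: linear_diff e_def)
    then have "norm (dg (L s) u) \<le> M' * norm ?f"
      using r3(3)[of "L s" ?f] LB[OF s] by (simp add: r_def)
    ultimately have "norm (Y' s) \<le> C * \<bar>g (L s)\<bar> + M * norm ?f + M' * norm ?f"
      using norm_Pair_le[of "frechet_derivative e (at (L s)) u" "dg (L s) u"] by (simp add: Y'_def)
    also have "\<dots> \<le> C * norm (Y s) + M * norm (Y s) + M' * norm (Y s)"
      using norm_fst_le[of "?f" "g (L s)"] norm_snd_le[of "g (L s)" "?f"] r1(2) r2(2) r3(2)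
      by (intro add_mono mult_left_mono) (auto simp: Y_def)
    finally show "norm (Y' s) \<le> (C + M + M') * norm (Y s)" by (simp add: algebra_simps)
  next
    show "Y 0 = 0" using eq mem_surface_iff q by (simp add: Y_def L_def zero_prod_def)
  qed
  have "q + s *\<^sub>R u \<in> \<Sigma> \<inter> B \<and> e (q + s *\<^sub>R u) = u" if s: "\<bar>s\<bar> < \<delta>" for s
  proof -
    have "L s \<in> B" using LB[OF s] r2(3) by (auto simp: r_def)
    then show ?thesis
      using Y0[OF s] mem_surface_iff[of "L s"] B(2) by (auto simp: Y_def L_def zero_prod_def)
  qed
  then show thesis using that \<delta> cf by blast
qed

end

text \<open>The leaf and the segment around \<open>b\<close> lie on the same parametrised line, and
  their parameter intervals overlap because \<open>b\<close> is in the closure of \<open>I\<close>.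
  Glued together they form a characteristic curve, so maximality puts \<open>b\<close> into
  \<open>I\<close>.\<close>

lemma leaf_not_extendable:
  assumes leaf: "leaf \<Sigma> I c" and line: "\<And>t. t \<in> I \<Longrightarrow> c t = P + t *\<^sub>R u"
    and b: "b \<in> closure I" and \<delta>: "\<delta> > 0" and e: "char_field \<Sigma> B e"
    and ext: "\<And>s. \<bar>s\<bar> < \<delta> \<Longrightarrow> P + (b + s) *\<^sub>R u \<in> \<Sigma> \<inter> B \<and> e (P + (b + s) *\<^sub>R u) = u"
  shows "b \<in> I"
proof -
  define J where "J = I \<union> {b - \<delta><..<b + \<delta>}"
  define l where "l t = P + t *\<^sub>R u" for t
  have cc: "char_curve \<Sigma> I c" using leaf by (simp add: leaf_def)
  have dl: "(l has_vector_derivative u) (at t)" for t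
    unfolding l_def[abs_def] by (auto intro!: derivative_eq_intros)
  have "I \<inter> {b - \<delta><..<b + \<delta>} \<noteq> {}"
  proof -
    have "b \<in> {b - \<delta><..<b + \<delta>}" using \<delta> by simp
    then have "{b - \<delta><..<b + \<delta>} \<inter> closure I \<noteq> {}" using b by blast
    then show ?thesis
      using open_Int_closure_eq_empty[of "{b - \<delta><..<b + \<delta>}" I] by (simp add: Int_commute)
  qed
  moreover have I: "open I" "connected I" "I \<noteq> {}"
    using cc by (auto simp: char_curve_def is_interval_connected)
  ultimately have J: "open J" "is_interval J" "J \<noteq> {}"
    unfolding J_def is_interval_connected_1 by (auto intro!: connected_Un)
  have "char_curve \<Sigma> J l"
    unfolding char_curve_def
  proof (intro conjI J ballI)
    fix t assume "t \<in> J"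
    then consider "t \<in> I" | "t \<in> {b - \<delta><..<b + \<delta>}" by (auto simp: J_def)
    then show "\<exists>U e. char_field \<Sigma> U e \<and>
        (\<forall>\<^sub>F s in nhds t. l s \<in> \<Sigma> \<inter> U \<and> (l has_vector_derivative e (l s)) (at s))"
    proof cases
      case 1
      then obtain U e where U: "char_field \<Sigma> U e"
        "\<forall>\<^sub>F s in nhds t. c s \<in> \<Sigma> \<inter> U \<and> (c has_vector_derivative e (c s)) (at s)"
        using cc unfolding char_curve_def by blast
      have "\<forall>\<^sub>F s in nhds t. s \<in> I" using I(1) 1 by (rule eventually_nhds_in_open)
      with U(2) have "\<forall>\<^sub>F s in nhds t. l s \<in> \<Sigma> \<inter> U \<and> (l has_vector_derivative e (l s)) (at s)"
      proof eventually_elim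
        case (elim s)
        have "(l has_vector_derivative e (c s)) (at s)"
          using elim I(1) line
          by (intro has_vector_derivative_transform_within_open[of c _ s I l]) (auto simp: l_def)
        then show ?case using elim line by (simp add: l_def)
      qed
      with U(1) show ?thesis by blast
    next
      case 2
      then have "\<forall>\<^sub>F s in nhds t. s \<in> {b - \<delta><..<b + \<delta>}"
        by (intro eventually_nhds_in_open) auto
      then have "\<forall>\<^sub>F s in nhds t. l s \<in> \<Sigma> \<inter> B \<and> (l has_vector_derivative e (l s)) (at s)"
      proof eventually_elim
        case (elim s)
        then show ?case using ext[of "s - b"] dl[of s] by (auto simp: l_def)
      qed
      with e show ?thesis by blast
    qed
  qed
  moreover have "I \<subseteq> J" "\<forall>t\<in>I. l t = c t" using line by (auto simp: J_def l_def)
  ultimately have "J = I"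
    by (intro leaf[unfolded leaf_def, THEN conjunct2, THEN spec, THEN spec, THEN mp] conjI)
  moreover have "b \<in> J" using \<delta> by (simp add: J_def)
  ultimately show ?thesis by simp
qed

text \<open>Here \<open>(a, b)\<close> is the gradient at a regular point and \<open>(u1, u2)\<close> the direction of the leaf
  through it.\<close>

lemma transversality:
  assumes "u1 * a + u2 * b = 0" "u1\<^sup>2 + u2\<^sup>2 = (1::real)" "C > 0" "a \<noteq> 0 \<or> b \<noteq> 0"
    "\<bar>a\<bar> \<le> C * \<bar>w1 * a + w2 * b\<bar>" "\<bar>b\<bar> \<le> C * \<bar>w1 * a + w2 * b\<bar>"
  shows "1 / (2 * C) \<le> \<bar>w1 * u2 - w2 * u1\<bar>" "w1 * a + w2 * b \<noteq> 0"
proof -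
  let ?k = "w1 * a + w2 * b" and ?b = "w1 * u2 - w2 * u1"
  show k: "?k \<noteq> 0" using assms(4-6) by auto
  \<comment> \<open>Being perpendicular to the unit vector \<open>(u1, u2)\<close>, the gradient
    \<open>(a, b)\<close> is its length times \<open>(u2, - u1)\<close> up to sign.\<close>
  have "?k\<^sup>2 = ?b\<^sup>2 * (a\<^sup>2 + b\<^sup>2)" using assms(1,2) by algebra
  also have "\<dots> \<le> ?b\<^sup>2 * ((C * \<bar>?k\<bar>)\<^sup>2 + (C * \<bar>?k\<bar>)\<^sup>2)"
    using assms(3,5,6) by (intro mult_left_mono add_mono) (auto simp: abs_le_square_iff[symmetric] abs_mult)
  \<comment> \<open>The factor 2 is weakened to 4 to obtain a perfect square.\<close>
  also have "\<dots> \<le> ?b\<^sup>2 * (4 * C\<^sup>2 * ?k\<^sup>2)"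
    by (intro mult_left_mono) (auto simp: power_mult_distrib)
  also have "\<dots> = (2 * C * ?b)\<^sup>2 * ?k\<^sup>2" by (simp add: power_mult_distrib)
  finally have "1\<^sup>2 \<le> (2 * C * ?b)\<^sup>2" using k by simp
  then have "\<bar>1\<bar> \<le> \<bar>2 * C * ?b\<bar>" by (simp only: abs_le_square_iff)
  then have "1 \<le> 2 * C * \<bar>?b\<bar>" using assms(3) by (simp only: abs_mult abs_of_pos abs_one abs_numeral)
  then have "1 \<le> \<bar>?b\<bar> * (2 * C)" by (simp only: mult.commute)
  then show "1 / (2 * C) \<le> \<bar>?b\<bar>" using assms(3) by (subst pos_divide_le_eq) simp_all
qed

lemma abs_quotient_le:
  assumes "2 * \<mu> \<le> \<bar>d\<bar>" "0 < \<mu>"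
  shows "\<bar>- 2 * k / d\<bar> \<le> \<bar>k\<bar> / (\<mu> :: real)"
proof -
  have "\<bar>- 2 * k / d\<bar> = 2 * \<bar>k\<bar> / \<bar>d\<bar>" by (simp add: abs_mult)
  also have "\<dots> \<le> 2 * \<bar>k\<bar> / (2 * \<mu>)" using assms by (intro divide_left_mono) auto
  finally show ?thesis by simp
qed

section \<open>Leaves near a singular curve\<close>

context slice_chart
begin

section \<open>The horizontal gradient at singular points\<close>

text \<open>The bracket relation of the frame applied to \<open>g\<close>: the second derivatives
  cancel by symmetry, and the derivatives of the coefficients \<open>y\<close> and \<open>-x\<close>
  of the frame fields each leave one vertical derivative.\<close>

lemma commutator_derivative:
  assumes x: "x \<in> U"
  shows "frechet_derivative g1 (at x) (std_e2 x) - frechet_derivative g2 (at x) (std_e1 x)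
    = 2 * dg x (axis 3 1)"
proof -
  define a where "a i y = dg y (axis i 1)" for i :: 3 and y
  have as: "smooth_on U (a i)" for i
    unfolding a_def[abs_def] by (rule smooth_on_frechet_derivative[OF smooth_g])
  let ?D = "\<lambda>i. frechet_derivative (a i) (at x)"
  have hd: "(a i has_derivative ?D i) (at x)" for i
    by (rule smooth_on_has_derivative[OF as x])
  have lin: "linear (?D i)" for i by (rule has_derivative_linear[OF hd])
  have sym: "?D i (axis j 1) = ?D j (axis i 1)" for i j
    unfolding a_def[abs_def] by (rule second_derivative_symmetric[OF smooth_g x])
  have nth: "((\<lambda>y. y $ i) has_derivative (\<lambda>v. v $ i)) (at x)" for i :: 3
    by (rule bounded_linear_imp_has_derivative[OF bounded_linear_vec_nth])
  have "((\<lambda>y. a 1 y + y$2 * a 3 y) has_derivative (\<lambda>v. ?D 1 v + (x$2 * ?D 3 v + v$2 * a 3 x))) (at x)"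
    by (intro has_derivative_add has_derivative_mult hd nth)
  then have "(g1 has_derivative (\<lambda>v. ?D 1 v + (x$2 * ?D 3 v + v$2 * a 3 x))) (at x)"
    by (rule has_derivative_transform_within_open[OF _ open_U x])
      (simp add: g1_def a_def std_e1_eq linear_add[OF dg_linear] linear_scale[OF dg_linear])
  then have 1: "frechet_derivative g1 (at x) = (\<lambda>v. ?D 1 v + (x$2 * ?D 3 v + v$2 * a 3 x))"
    by (rule frechet_derivative_at[symmetric])
  have "((\<lambda>y. a 2 y - y$1 * a 3 y) has_derivative (\<lambda>v. ?D 2 v - (x$1 * ?D 3 v + v$1 * a 3 x))) (at x)"
    by (intro has_derivative_diff has_derivative_mult hd nth)
  then have "(g2 has_derivative (\<lambda>v. ?D 2 v - (x$1 * ?D 3 v + v$1 * a 3 x))) (at x)"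
    by (rule has_derivative_transform_within_open[OF _ open_U x])
      (simp add: g2_def a_def std_e2_eq linear_neg[OF dg_linear] linear_diff[OF dg_linear] linear_scale[OF dg_linear])
  then have 2: "frechet_derivative g2 (at x) = (\<lambda>v. ?D 2 v - (x$1 * ?D 3 v + v$1 * a 3 x))"
    by (rule frechet_derivative_at[symmetric])
  show ?thesis
    unfolding 1 2 using sym[of 1 2] sym[of 1 3] sym[of 2 3]
    by (simp add: std_e1_eq std_e2_eq linear_add[OF lin] linear_scale[OF lin] linear_neg[OF lin]
        linear_diff[OF lin] algebra_simps axis_nth_3) (simp add: a_def)
qed

text \<open>Let A be the 2 by 2 matrix of horizontal derivatives of \<open>g1\<close> and
  \<open>g2\<close> at \<open>p\<close>. Here \<open>w\<close> is horizontal because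
  \<open>dg p\<close> is purely vertical and nonzero, so A annihilates \<open>w\<close>. Pairing
  \<open>w\<close> with the image of \<open>v\<close> then sees only the antisymmetric part of A,
  given by \<open>commutator_derivative\<close>.\<close>

lemma singular_point_derivative:
  assumes p: "p \<in> U" "g1 p = 0" "g2 p = 0" and w0: "w \<noteq> 0" and w: "dg p w = 0"
    "frechet_derivative g1 (at p) w = 0" "frechet_derivative g2 (at p) w = 0"
    and v: "contact_form p v = 0"
  shows "dg p (axis 3 1) \<noteq> 0" "contact_form p w = 0"
    "w$1 * frechet_derivative g1 (at p) v + w$2 * frechet_derivative g2 (at p) v =
      2 * dg p (axis 3 1) * (w$1 * v$2 - w$2 * v$1)"
proof -
  let ?A1 = "frechet_derivative g1 (at p)" and ?A2 = "frechet_derivative g2 (at p)"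
  obtain z where "dg p z \<noteq> 0" using dg_nonzero[OF p(1)] by blast
  then show m: "dg p (axis 3 1) \<noteq> 0" using dg_frame[OF p(1), of z] p by auto
  show wc: "contact_form p w = 0" using w(1) m dg_frame[OF p(1), of w] p by auto
  have lin: "linear ?A1" "linear ?A2"
    using has_derivative_linear[OF smooth_on_has_derivative[OF smooth_g1 p(1)]]
      has_derivative_linear[OF smooth_on_has_derivative[OF smooth_g2 p(1)]] by auto
  have A: "?A1 u = u$1 * ?A1 (std_e1 p) + u$2 * ?A1 (std_e2 p)"
    "?A2 u = u$1 * ?A2 (std_e1 p) + u$2 * ?A2 (std_e2 p)" if "contact_form p u = 0" for u
    using arg_cong[OF horizontal_decomposition[OF that], of ?A1]
      arg_cong[OF horizontal_decomposition[OF that], of ?A2] lin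
    by (simp_all add: linear_add linear_scale)
  have "w$1 * ?A1 (std_e1 p) + w$2 * ?A1 (std_e2 p) = 0" "w$1 * ?A2 (std_e1 p) + w$2 * ?A2 (std_e2 p) = 0"
    using A[OF wc] w by auto
  moreover have "?A1 (std_e2 p) - ?A2 (std_e1 p) = 2 * dg p (axis 3 1)"
    by (rule commutator_derivative[OF p(1)])
  ultimately show "w$1 * ?A1 v + w$2 * ?A2 v = 2 * dg p (axis 3 1) * (w$1 * v$2 - w$2 * v$1)"
    unfolding A[OF v] by algebra
qed

lemma frechet_derivative_combination:
  assumes "x \<in> U"
  shows "frechet_derivative (\<lambda>x. a * g1 x + b * g2 x) (at x) v =
    a * frechet_derivative g1 (at x) v + b * frechet_derivative g2 (at x) v"
proof -
  have "((\<lambda>x. a * g1 x + b * g2 x) has_derivative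
     (\<lambda>v. a * frechet_derivative g1 (at x) v + b * frechet_derivative g2 (at x) v)) (at x)"
    by (intro has_derivative_add has_derivative_mult_right smooth_on_has_derivative[OF smooth_g1 assms]
        smooth_on_has_derivative[OF smooth_g2 assms])
  from fun_cong[OF frechet_derivative_at[OF this], of v] show ?thesis by (rule sym)
qed

lemma derivative_along_curve_zero:
  assumes f: "smooth_on U f" and \<gamma>: "(\<gamma> has_vector_derivative w) (at t0)" and t0: "\<gamma> t0 \<in> U"
    and 0: "\<forall>\<^sub>F t in nhds t0. f (\<gamma> t) = (0::real)"
  shows "frechet_derivative f (at (\<gamma> t0)) w = 0"
proof -
  have hd: "(f has_derivative frechet_derivative f (at (\<gamma> t0))) (at (\<gamma> t0))"
    by (rule smooth_on_has_derivative[OF f t0])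
  have "((\<lambda>t. f (\<gamma> t)) has_derivative (\<lambda>h. frechet_derivative f (at (\<gamma> t0)) (h *\<^sub>R w))) (at t0)"
    by (rule has_derivative_compose[OF \<gamma>[unfolded has_vector_derivative_def] hd])
  moreover have "((\<lambda>t. f (\<gamma> t)) has_derivative (\<lambda>h. 0)) (at t0)"
    by (rule has_derivative_transform_eventually[OF has_derivative_const[of 0]])
      (use 0 eventually_nhds_x_imp_x[OF 0] in \<open>auto simp: eventually_at_filter elim: eventually_mono\<close>)
  ultimately have "(\<lambda>h. frechet_derivative f (at (\<gamma> t0)) (h *\<^sub>R w)) = (\<lambda>h. 0)"
    by (rule has_derivative_unique)
  from fun_cong[OF this, of 1] show ?thesis by simp
qed

text \<open>Each \<open>x\<close> is paired with a point of the curve in the same hyperplane normal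
  to \<open>w\<close>. Their distance is at most a multiple of \<open>\<bar>?k x\<bar>\<close>,
  since \<open>g\<close> vanishes at both points and \<open>g\<close>, \<open>?k\<close> and
  \<open>w\<close> together have injective differential at \<open>p\<close>. Lipschitz continuity of
  \<open>g1\<close> and \<open>g2\<close> concludes.\<close>

lemma gradient_le_near_singular_curve:
  assumes I: "open I" "connected I" "t0 \<in> I" and \<gamma>: "continuous_on I \<gamma>"
    and w: "(\<gamma> has_vector_derivative w) (at t0)" "w \<noteq> 0"
    and sing: "\<gamma> ` I \<subseteq> singular_set \<Sigma>" and p: "\<gamma> t0 = p" "p \<in> U"
  obtains r C where "r > 0" "C > 0" "ball p r \<subseteq> U"
    "\<And>x. x \<in> \<Sigma> \<inter> ball p r \<Longrightarrow> \<bar>g1 x\<bar> \<le> C * \<bar>w$1 * g1 x + w$2 * g2 x\<bar> \<and>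
      \<bar>g2 x\<bar> \<le> C * \<bar>w$1 * g1 x + w$2 * g2 x\<bar>"
    "dg p (axis 3 1) \<noteq> 0" "g1 p = 0" "g2 p = 0"
    "\<And>v. contact_form p v = 0 \<Longrightarrow> frechet_derivative (\<lambda>x. w$1 * g1 x + w$2 * g2 x) (at p) v =
      2 * dg p (axis 3 1) * (w$1 * v$2 - w$2 * v$1)"
proof -
  let ?k = "\<lambda>x. w$1 * g1 x + w$2 * g2 x"
  let ?Dk = "frechet_derivative ?k (at p)"
  have ks: "smooth_on U ?k"
    by (intro smooth_on_add smooth_on_mult smooth_on_const open_U smooth_g1 smooth_g2)
  have zero: "g (\<gamma> t) = 0 \<and> g1 (\<gamma> t) = 0 \<and> g2 (\<gamma> t) = 0" if "t \<in> I" "\<gamma> t \<in> U" for t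
    using sing that singular_iff[of "\<gamma> t"] mem_surface_iff[of "\<gamma> t"] by (auto simp: singular_set_def)
  have "isCont \<gamma> t0" using I \<gamma> continuous_on_eq_continuous_at by blast
  then have "\<forall>\<^sub>F t in nhds t0. \<gamma> t \<in> U"
    by (rule isCont_eventually_nhds) (use p open_U in auto)
  moreover have "\<forall>\<^sub>F t in nhds t0. t \<in> I" using I by (intro eventually_nhds_in_open)
  ultimately have ev: "\<forall>\<^sub>F t in nhds t0. g (\<gamma> t) = 0 \<and> g1 (\<gamma> t) = 0 \<and> g2 (\<gamma> t) = 0"
    by eventually_elim (use zero in blast)
  have tang: "dg p w = 0" "frechet_derivative g1 (at p) w = 0" "frechet_derivative g2 (at p) w = 0"
    using derivative_along_curve_zero[OF smooth_g w(1)] derivative_along_curve_zero[OF smooth_g1 w(1)]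
      derivative_along_curve_zero[OF smooth_g2 w(1)] ev p by (auto simp: eventually_conj_iff)
  have gp: "g1 p = 0" "g2 p = 0" using zero[OF I(3)] p by auto
  have fac: "dg p (axis 3 1) \<noteq> 0" "contact_form p w = 0"
    "\<And>v. contact_form p v = 0 \<Longrightarrow> ?Dk v = 2 * dg p (axis 3 1) * (w$1 * v$2 - w$2 * v$1)"
    using singular_point_derivative[OF p(2) gp w(2) tang, of 0]
      singular_point_derivative(3)[OF p(2) gp w(2) tang]
    by (simp_all add: contact_form_def[of p 0] frechet_derivative_combination[OF p(2)])
  \<comment> \<open>A vector in the kernel is horizontal by the first component, parallel to
    \<open>w\<close> by the second and orthogonal to \<open>w\<close> by the third, hence
    zero.\<close>
  define \<Lambda> where "\<Lambda> d = (dg p d, ?Dk d, w \<bullet> d)" for d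
  have linDk: "linear ?Dk" by (rule has_derivative_linear[OF smooth_on_has_derivative[OF ks p(2)]])
  have lin: "linear \<Lambda>"
    unfolding \<Lambda>_def[abs_def]
    by (rule linearI) (simp_all add: linear_add[OF linDk] linear_scale[OF linDk]
        linear_add[OF dg_linear[OF p(2)]] linear_scale[OF dg_linear[OF p(2)]] inner_add_right)
  have "inj \<Lambda>"
    unfolding linear_injective_0[OF lin]
  proof (intro allI impI)
    fix d assume "\<Lambda> d = 0"
    then have d: "dg p d = 0" "?Dk d = 0" "w \<bullet> d = 0" by (auto simp: \<Lambda>_def zero_prod_def)
    have dc: "contact_form p d = 0" using d(1) dg_frame[OF p(2), of d] gp fac(1) by simp
    then have par: "w$1 * d$2 = w$2 * d$1" using fac(1,3) d(2) by simp
    have "w$1 \<noteq> 0 \<or> w$2 \<noteq> 0" using w(2) horizontal_decomposition[OF fac(2)] by auto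
    then have nz: "(w$1)\<^sup>2 + (w$2)\<^sup>2 \<noteq> 0" by simp
    define a where "a = (w$1 * d$1 + w$2 * d$2) / ((w$1)\<^sup>2 + (w$2)\<^sup>2)"
    have "d$1 * ((w$1)\<^sup>2 + (w$2)\<^sup>2) = (w$1 * d$1 + w$2 * d$2) * w$1"
      "d$2 * ((w$1)\<^sup>2 + (w$2)\<^sup>2) = (w$1 * d$1 + w$2 * d$2) * w$2"
      using par by algebra+
    then have "d$1 = a * w$1" "d$2 = a * w$2" 
      by (simp_all only: a_def times_divide_eq_left nonzero_eq_divide_eq[OF nz])
    then have "d = a *\<^sub>R w"
      using horizontal_decomposition[OF dc] horizontal_decomposition[OF fac(2)]
      by (metis scaleR_add_right scaleR_scaleR)
    with d(3) w(2) show "d = 0" by simp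
  qed
  then obtain c0 where c0: "c0 > 0" "\<And>d. c0 * norm d \<le> norm (\<Lambda> d)"
    using linear_inj_bounded_below_pos[OF lin] by blast
  have \<Lambda>_le: "norm (\<Lambda> d) \<le> \<bar>dg p d\<bar> + \<bar>?Dk d\<bar> + \<bar>w \<bullet> d\<bar>" for d
    using norm_Pair_le[of "dg p d" "(?Dk d, w \<bullet> d)"] norm_Pair_le[of "?Dk d" "w \<bullet> d"]
    by (simp add: \<Lambda>_def)
  \<comment> \<open>The linearisation errors of \<open>g\<close> and \<open>?k\<close> together use
    up half of the lower bound \<open>c0\<close>; the other half controls the distance to the
    curve.\<close>
  have e: "c0 / 4 > 0" using c0 by simp
  obtain r1 where r1: "r1 > 0" "ball p r1 \<subseteq> U"
    "\<And>x y. x \<in> ball p r1 \<Longrightarrow> y \<in> ball p r1 \<Longrightarrow> norm (g y - g x - dg p (y - x)) \<le> c0 / 4 * norm (y - x)"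
    using smooth_on_strict_derivative[OF smooth_g p(2) e] by blast
  obtain r2 where r2: "r2 > 0" "ball p r2 \<subseteq> U"
    "\<And>x y. x \<in> ball p r2 \<Longrightarrow> y \<in> ball p r2 \<Longrightarrow> norm (?k y - ?k x - ?Dk (y - x)) \<le> c0 / 4 * norm (y - x)"
    using smooth_on_strict_derivative[OF ks p(2) e] by blast
  obtain r3 L1 where r3: "r3 > 0" "L1 > 0" "ball p r3 \<subseteq> U"
    "\<And>x y. x \<in> ball p r3 \<Longrightarrow> y \<in> ball p r3 \<Longrightarrow> norm (g1 y - g1 x) \<le> L1 * norm (y - x)"
    using smooth_on_Lipschitz[OF smooth_g1 p(2)] by blast
  obtain r4 L2 where r4: "r4 > 0" "L2 > 0" "ball p r4 \<subseteq> U"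
    "\<And>x y. x \<in> ball p r4 \<Longrightarrow> y \<in> ball p r4 \<Longrightarrow> norm (g2 y - g2 x) \<le> L2 * norm (y - x)"
    using smooth_on_Lipschitz[OF smooth_g2 p(2)] by blast
  define R where "R = min (min r1 r2) (min r3 r4)"
  have R: "R > 0" "ball p R \<subseteq> U" using r1 r2 r3 r4 by (auto simp: R_def)
  \<comment> \<open>The sum \<open>L1 + L2\<close> dominates both Lipschitz constants, and
    \<open>2 / c0\<close> comes from the distance estimate.\<close>
  define C where "C = (L1 + L2) * (2 / c0)"
  have C: "C > 0" using r3 r4 c0 by (simp add: C_def)
  obtain r5 where r5: "r5 > 0" "\<And>x. dist x p < r5 \<Longrightarrow> \<exists>t\<in>I. \<gamma> t \<in> ball p R \<and> w \<bullet> (x - \<gamma> t) = 0"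
    using curve_meets_normal_hyperplanes[OF I \<gamma> w R(1)] p unfolding eventually_nhds_metric by auto
  have est: "\<bar>g1 x\<bar> \<le> C * \<bar>?k x\<bar> \<and> \<bar>g2 x\<bar> \<le> C * \<bar>?k x\<bar>" if x: "x \<in> \<Sigma> \<inter> ball p (min R r5)" for x
  proof -
    obtain t where t: "t \<in> I" "\<gamma> t \<in> ball p R" "w \<bullet> (x - \<gamma> t) = 0"
      using r5(2)[of x] x by (auto simp: dist_commute)
    have xR: "x \<in> ball p R" using x by auto
    have "g x = 0" using x R mem_surface_iff by auto
    moreover have z: "g (\<gamma> t) = 0" "g1 (\<gamma> t) = 0" "g2 (\<gamma> t) = 0" using zero t R by auto
    ultimately have 1: "\<bar>dg p (x - \<gamma> t)\<bar> \<le> c0 / 4 * norm (x - \<gamma> t)"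
      using r1(3)[of "\<gamma> t" x] t xR by (simp add: R_def)
    have 2: "\<bar>?k x - ?Dk (x - \<gamma> t)\<bar> \<le> c0 / 4 * norm (x - \<gamma> t)"
      using r2(3)[of "\<gamma> t" x] t xR z by (simp add: R_def)
    have "c0 * norm (x - \<gamma> t) \<le> c0 / 2 * norm (x - \<gamma> t) + \<bar>?k x\<bar>"
      using c0(2)[of "x - \<gamma> t"] \<Lambda>_le[of "x - \<gamma> t"] 1 2 t(3) by linarith
    then have d: "norm (x - \<gamma> t) \<le> 2 / c0 * \<bar>?k x\<bar>" using c0(1) by (simp add: field_simps)
    have "\<bar>g1 x\<bar> \<le> L1 * norm (x - \<gamma> t)" "\<bar>g2 x\<bar> \<le> L2 * norm (x - \<gamma> t)"
      using r3(4)[of "\<gamma> t" x] r4(4)[of "\<gamma> t" x] t xR z by (auto simp: R_def)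
    moreover have "L1 * norm (x - \<gamma> t) \<le> (L1 + L2) * (2 / c0 * \<bar>?k x\<bar>)"
      "L2 * norm (x - \<gamma> t) \<le> (L1 + L2) * (2 / c0 * \<bar>?k x\<bar>)"
      using r3(2) r4(2) d c0 by (intro mult_mono; simp)+
    ultimately show ?thesis by (simp only: C_def mult.assoc) linarith
  qed
  show thesis
    using R r5(1) by (intro that[OF _ C _ est fac(1) gp fac(3), of "min R r5"]) auto
qed

section \<open>Leaves run into the singular curve\<close>

text \<open>All constants are fixed at \<open>p\<close> before the leaf is chosen; this uniformity
  gives one neighbourhood for leaves of every direction.\<close>

lemma leaves_near_singular_point:
  assumes min: "p_minimal_surface \<Sigma>"
    and I: "open I" "connected I" "t0 \<in> I" and \<gamma>: "continuous_on I \<gamma>"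
    and w: "(\<gamma> has_vector_derivative w) (at t0)" "w \<noteq> 0"
    and sing: "\<gamma> ` I \<subseteq> singular_set \<Sigma>" and p: "\<gamma> t0 = p" "p \<in> U"
    and U0: "open U0" "p \<in> U0" "singular_set \<Sigma> \<inter> U0 = \<Gamma> \<inter> U0"
  shows "\<forall>\<^sub>F q in nhds p. \<forall>J c. leaf \<Sigma> J c \<and> q \<in> c ` J \<longrightarrow> extends_smoothly_to J c \<Gamma>"
proof -
  define k where "k x = w$1 * g1 x + w$2 * g2 x" for x
  let ?Dk = "frechet_derivative k (at p)"
  have ks: "smooth_on U k"
    unfolding k_def[abs_def]
    by (intro smooth_on_add smooth_on_mult smooth_on_const open_U smooth_g1 smooth_g2)
  obtain r C where r: "r > 0" and C: "C > 0" and rU: "ball p r \<subseteq> U"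
    and est: "\<And>x. x \<in> \<Sigma> \<inter> ball p r \<Longrightarrow> \<bar>g1 x\<bar> \<le> C * \<bar>k x\<bar> \<and> \<bar>g2 x\<bar> \<le> C * \<bar>k x\<bar>"
    and m: "dg p (axis 3 1) \<noteq> 0" and gp: "g1 p = 0" "g2 p = 0"
    and Dk: "\<And>v. contact_form p v = 0 \<Longrightarrow> ?Dk v = 2 * dg p (axis 3 1) * (w$1 * v$2 - w$2 * v$1)"
    using gradient_le_near_singular_curve[OF I \<gamma> w sing p, folded k_def] by blast
  \<comment> \<open>Chosen so that \<open>2 * \<mu> \<le> \<bar>?Dk u\<bar>\<close> for leaf
    directions: transversality makes the horizontal part at least \<open>4 * \<mu>\<close>, and the
    vertical part costs less than \<open>2 * \<mu>\<close>.\<close>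
  define \<mu> where "\<mu> = \<bar>dg p (axis 3 1)\<bar> / (4 * C)"
  have \<mu>: "\<mu> > 0" using m C by (simp add: \<mu>_def)
  define \<tau> where "\<tau> = ?Dk (axis 3 1)"
  \<comment> \<open>Bounds \<open>norm u\<close>: two components are at most \<open>1\<close>, and
    the third is at most \<open>2 * norm q\<close>, where
    \<open>norm q \<le> norm p + 1\<close>.\<close>
  define K where "K = 4 + 2 * norm p"
  have K: "K > 0" by (simp add: K_def add_pos_nonneg)
  obtain r1 where r1: "r1 > 0" "ball p r1 \<subseteq> U"
    "\<And>x y. x \<in> ball p r1 \<Longrightarrow> y \<in> ball p r1 \<Longrightarrow> norm (k y - k x - ?Dk (y - x)) \<le> \<mu> / K * norm (y - x)"
    using smooth_on_strict_derivative[OF ks p(2), of "\<mu> / K"] \<mu> K by (auto intro: divide_pos_pos)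
  obtain r2 where r2: "r2 > 0" "ball p r2 \<subseteq> U0" using U0 open_contains_ball by blast
  define R where "R = min (min r r1) (min r2 1)"
  have R: "R > 0" "R \<le> 1" "ball p R \<subseteq> U" "ball p R \<subseteq> U0" using r rU r1 r2 by (auto simp: R_def)
  have linDk: "linear ?Dk" by (rule has_derivative_linear[OF smooth_on_has_derivative[OF ks p(2)]])
  have kp: "k p = 0" using gp by (simp add: k_def)
  \<comment> \<open>The second summand bounds the length of the segment along which the leaf will be
    followed, so the segment stays in \<open>ball p R\<close>.\<close>
  have "isCont (\<lambda>x. dist x p + \<bar>k x\<bar> / \<mu> * K) p"
    using \<mu> by (intro continuous_intros smooth_on_continuous[OF ks p(2)]) auto
  from isCont_eventually_nhds[OF this, of "{..<R}"]
  have small1: "\<forall>\<^sub>F q in nhds p. dist q p + \<bar>k q\<bar> / \<mu> * K < R"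
    using kp R(1) by simp
  have "((\<lambda>q. 2 * dist q p * \<bar>\<tau>\<bar>) \<longlongrightarrow> 2 * dist p p * \<bar>\<tau>\<bar>) (nhds p)"
    by (intro tendsto_intros filterlim_ident)
  then have small2: "\<forall>\<^sub>F q in nhds p. 2 * dist q p * \<bar>\<tau>\<bar> < 2 * \<mu>"
    using \<mu> by (intro order_tendstoD(2)) auto
  from small1 small2 show ?thesis
  proof (eventually_elim, intro allI impI, elim conjE)
    fix q J c
    assume q1: "dist q p + \<bar>k q\<bar> / \<mu> * K < R" and q2: "2 * dist q p * \<bar>\<tau>\<bar> < 2 * \<mu>"
      and leaf: "leaf \<Sigma> J c" and "q \<in> c ` J"
    then obtain s0 where s0: "s0 \<in> J" "q = c s0" by blast
    have cc: "char_curve \<Sigma> J c" using leaf by (simp add: leaf_def)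
    then have J: "open J" "is_interval J" by (auto simp: char_curve_def)
    obtain P u where line: "\<And>t. t \<in> J \<Longrightarrow> c t = P + t *\<^sub>R u" and unit: "(u$1)\<^sup>2 + (u$2)\<^sup>2 = 1"
      and reg: "\<And>t. t \<in> J \<Longrightarrow> c t \<in> regular_part \<Sigma> \<and> u \<in> tangent_plane \<Sigma> (c t) \<and> contact_form (c t) u = 0"
      using char_curve_line[OF min cc] by metis
    have qP: "q = P + s0 *\<^sub>R u" using s0 line by simp
    have "\<bar>k q\<bar> / \<mu> * K \<ge> 0" using \<mu> K by simp
    then have dq: "dist q p < R" using q1 by linarith
    then have qR: "q \<in> ball p R" by (simp add: dist_commute)
    have q\<Sigma>: "q \<in> \<Sigma>" "q \<in> U" "q \<notin> singular_set \<Sigma>"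
      using reg[OF s0(1)] s0(2) qR R by (auto simp: regular_part_def)
    have perp: "u$1 * g1 q + u$2 * g2 q = 0"
      using reg[OF s0(1)] s0(2) tangent_plane_eq[OF q\<Sigma>(1,2)] dg_frame[OF q\<Sigma>(2), of u] by simp
    have "g1 q \<noteq> 0 \<or> g2 q \<noteq> 0" using singular_iff[OF q\<Sigma>(1,2)] q\<Sigma>(3) by blast
    then have tr: "1 / (2 * C) \<le> \<bar>w$1 * u$2 - w$2 * u$1\<bar>" and kq: "k q \<noteq> 0"
      using transversality[OF perp unit C, of "w$1" "w$2"] est[of q] q\<Sigma>(1) qR
      by (auto simp: R_def k_def)
    have hor: "contact_form P u = 0" using reg[OF s0(1)] s0(2) qP by (metis contact_form_translate)
    have uabs: "\<bar>u$1\<bar> \<le> 1" "\<bar>u$2\<bar> \<le> 1"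
      using unit by (auto simp: abs_square_le_1[symmetric]) (smt (verit) zero_le_power2)+
    \<comment> \<open>The direction \<open>u\<close> is horizontal at \<open>q\<close>, not
      necessarily at \<open>p\<close>; this is its vertical component at \<open>p\<close>, small
      with \<open>dist q p\<close>.\<close>
    define \<theta> where "\<theta> = contact_form p u"
    have "\<theta> = contact_form p u - contact_form q u" using hor qP by (simp add: \<theta>_def)
    also have "\<dots> = (p - q)$1 * u$2 - (p - q)$2 * u$1" by (simp add: contact_form_def algebra_simps)
    finally have "\<bar>\<theta>\<bar> \<le> \<bar>(p - q)$1\<bar> * \<bar>u$2\<bar> + \<bar>(p - q)$2\<bar> * \<bar>u$1\<bar>" by (simp flip: abs_mult)
    also have "\<dots> \<le> norm (p - q) * 1 + norm (p - q) * 1"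
      using uabs by (intro add_mono mult_mono component_le_norm_cart) auto
    finally have \<theta>: "\<bar>\<theta>\<bar> \<le> 2 * dist q p" by (simp add: dist_norm norm_minus_commute)
    have uK: "norm u \<le> K"
    proof -
      have "contact_form q u = 0" using hor qP by simp
      then have "u$3 = q$2 * u$1 - q$1 * u$2" by (simp add: contact_form_def)
      then have "\<bar>u$3\<bar> \<le> \<bar>q$2\<bar> * \<bar>u$1\<bar> + \<bar>q$1\<bar> * \<bar>u$2\<bar>" by (simp flip: abs_mult)
      also have "\<dots> \<le> norm q * 1 + norm q * 1"
        using uabs by (intro add_mono mult_mono component_le_norm_cart) auto
      finally have "\<bar>u$3\<bar> \<le> 2 * norm q" by simp
      moreover have "norm q \<le> norm p + 1"
        using dq R(2) norm_triangle_sub[of q p] by (simp add: dist_norm)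
      ultimately show ?thesis
        using norm_le_l1_cart[of u] uabs by (simp add: sum_3 K_def)
    qed
    let ?h = "u$1 *\<^sub>R std_e1 p + u$2 *\<^sub>R std_e2 p"
    have "?Dk u = ?Dk ?h + \<theta> * \<tau>"
      using arg_cong[OF frame_decomposition[of u p], of ?Dk]
      by (simp add: linear_add[OF linDk] linear_scale[OF linDk] \<theta>_def \<tau>_def std_T_eq)
    moreover have "?Dk ?h = 2 * dg p (axis 3 1) * (w$1 * u$2 - w$2 * u$1)"
      using Dk[of ?h] by (simp add: contact_form_def algebra_simps)
    moreover have "4 * \<mu> \<le> \<bar>2 * dg p (axis 3 1) * (w$1 * u$2 - w$2 * u$1)\<bar>"
      using mult_left_mono[OF tr, of "2 * \<bar>dg p (axis 3 1)\<bar>"] by (simp add: \<mu>_def abs_mult)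
    moreover have "\<bar>\<theta> * \<tau>\<bar> < 2 * \<mu>"
      using q2 mult_right_mono[OF \<theta>, of "\<bar>\<tau>\<bar>"] by (simp add: abs_mult)
    ultimately have D: "2 * \<mu> \<le> \<bar>?Dk u\<bar>" by linarith
    \<comment> \<open>Twice the Newton step towards a zero of \<open>k\<close>: to first order
      \<open>k\<close> goes from \<open>k q\<close> to \<open>- k q\<close>, and an error of at most
      \<open>\<bar>k q\<bar>\<close> still forces a zero on the way.\<close>
    define S where "S = - 2 * k q / ?Dk u"
    have D0: "?Dk u \<noteq> 0" using D \<mu> by auto
    have Sle: "\<bar>S\<bar> \<le> \<bar>k q\<bar> / \<mu>"
      unfolding S_def by (rule abs_quotient_le[OF D \<mu>])
    have inR: "q + (x * S) *\<^sub>R u \<in> ball p R" if x: "0 \<le> x" "x \<le> 1" for x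
    proof -
      have "\<bar>x * S\<bar> \<le> \<bar>S\<bar>" using x by (simp add: abs_mult mult_left_le_one_le)
      then have "norm ((x * S) *\<^sub>R u) \<le> \<bar>k q\<bar> / \<mu> * K"
        using Sle uK by (simp only: norm_scaleR) (intro mult_mono, auto)
      then have "dist (q + (x * S) *\<^sub>R u) q \<le> \<bar>k q\<bar> / \<mu> * K" by (simp add: dist_norm)
      then show ?thesis
        using q1 dist_triangle[of "q + (x * S) *\<^sub>R u" p q] by (simp add: dist_commute)
    qed
    \<comment> \<open>The factor \<open>k q\<close> removes the case distinction on its sign: the
      values are nonnegative at \<open>0\<close> and nonpositive at \<open>1\<close>.\<close>
    let ?f = "\<lambda>x. k (q + (x * S) *\<^sub>R u) * k q"
    have "norm (k (q + S *\<^sub>R u) - k q - ?Dk (S *\<^sub>R u)) \<le> \<mu> / K * norm (S *\<^sub>R u)"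
      using r1(3)[of q "q + S *\<^sub>R u"] inR[of 1] qR by (simp add: R_def)
    also have "\<dots> \<le> \<mu> / K * (\<bar>k q\<bar> / \<mu> * K)"
      using Sle uK \<mu> K by (simp only: norm_scaleR) (intro mult_left_mono mult_mono, auto)
    also have "\<dots> = \<bar>k q\<bar>" using \<mu> K by simp
    finally have "\<bar>k (q + S *\<^sub>R u) - k q - ?Dk (S *\<^sub>R u)\<bar> \<le> \<bar>k q\<bar>" by simp
    moreover have "?Dk (S *\<^sub>R u) = - 2 * k q"
      using D0 by (simp only: linear_scale[OF linDk]) (simp add: S_def)
    ultimately have "\<bar>k (q + S *\<^sub>R u) + k q\<bar> \<le> \<bar>k q\<bar>" by simp
    then have f1: "?f 1 \<le> 0" using mult_le_0_iff[of "k (q + S *\<^sub>R u)" "k q"] by (simp only: mult_1) linarith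
    have f0: "0 \<le> ?f 0" by simp
    have "continuous_on {0..1} ?f"
    proof (intro continuous_at_imp_continuous_on ballI)
      fix x :: real assume "x \<in> {0..1}"
      then have xU: "q + (x * S) *\<^sub>R u \<in> U" using inR[of x] R by auto
      have "isCont (\<lambda>x. k (q + (x * S) *\<^sub>R u)) x"
        by (rule isCont_o2[where f="\<lambda>x. q + (x * S) *\<^sub>R u", OF _ smooth_on_continuous[OF ks xU]]) (intro continuous_intros)
      then show "isCont ?f x" by (intro continuous_intros)
    qed
    then obtain x1 where x1: "0 \<le> x1" "x1 \<le> 1" "?f x1 = 0"
      using IVT2'[of ?f 1 0 0] f0 f1 by auto
    then have kx1: "k (q + (x1 * S) *\<^sub>R u) = 0" using kq by simp
    define s1 where "s1 = s0 + x1 * S"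
    have seg: "P + b *\<^sub>R u \<in> ball p R" if b: "b \<in> closed_segment s0 s1" for b
    proof -
      obtain y where y: "0 \<le> y" "y \<le> 1" "b = (1 - y) *\<^sub>R s0 + y *\<^sub>R s1"
        using b[unfolded in_segment(1)] by (elim exE conjE)
      then have "b = s0 + y * x1 * S" by (simp add: s1_def algebra_simps)
      then have "P + b *\<^sub>R u = q + ((y * x1) * S) *\<^sub>R u"
        by (simp add: qP scaleR_add_left add.assoc)
      moreover have "0 \<le> y * x1" "y * x1 \<le> 1" using y x1 by (auto intro: mult_le_one)
      ultimately show ?thesis using inR by simp
    qed
    \<comment> \<open>At \<open>s1\<close> the function \<open>k\<close> vanishes, hence by
      \<open>est\<close> the whole horizontal gradient, whereas leaves consist of regular
      points.\<close>
    have "s1 \<notin> J"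
    proof
      assume s1: "s1 \<in> J"
      have c1: "c s1 = q + (x1 * S) *\<^sub>R u" using line[OF s1] by (simp add: s1_def qP algebra_simps)
      then have "c s1 \<in> ball p R" using inR x1 by simp
      moreover have "c s1 \<in> \<Sigma>" "c s1 \<notin> singular_set \<Sigma>" using reg[OF s1] by (auto simp: regular_part_def)
      ultimately show False
        using est[of "c s1"] kx1 c1 singular_iff[of "c s1"] R by (auto simp: R_def)
    qed
    then obtain b where b: "b \<in> closed_segment s0 s1" "b \<in> frontier J"
      using connected_Int_frontier[of "closed_segment s0 s1" J] s0(1) by auto
    have bcl: "b \<in> closure J" and bJ: "b \<notin> J"
      using b(2) J(1) by (auto simp: frontier_def interior_open)
    define x where "x = P + b *\<^sub>R u"
    have xR: "x \<in> ball p R" using seg[OF b(1)] by (simp add: x_def)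
    then have xU: "x \<in> U" using R by auto
    have lc: "isCont (\<lambda>t. P + t *\<^sub>R u) b" by (intro continuous_intros)
    have "\<forall>\<^sub>F t in nhds b. P + t *\<^sub>R u \<in> U"
      by (rule isCont_eventually_nhds[OF lc open_U]) (use xU in \<open>simp add: x_def\<close>)
    then have ev: "\<forall>\<^sub>F t in nhds b. t \<in> J \<longrightarrow> g (P + t *\<^sub>R u) = 0 \<and> dg (P + t *\<^sub>R u) u = 0"
    proof eventually_elim
      case (elim t)
      then show ?case
        using line reg mem_surface_iff[of "c t"] tangent_plane_eq[of "c t"] by (fastforce simp: regular_part_def)
    qed
    \<comment> \<open>Membership in the surface and tangency of \<open>u\<close> are closed
      conditions, so they persist at the end point of the leaf.\<close>
    have "g x = 0"
      unfolding x_def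
      by (rule closure_zero[OF isCont_o2[OF lc smooth_on_continuous[OF smooth_g xU[unfolded x_def]]] bcl])
        (use ev in \<open>auto elim: eventually_mono\<close>)
    then have x\<Sigma>: "x \<in> \<Sigma>" using mem_surface_iff[OF xU] by simp
    have dgx: "dg x u = 0"
      unfolding x_def
      by (rule closure_zero[OF isCont_o2[OF lc smooth_on_continuous[OF smooth_on_frechet_derivative[OF smooth_g] xU[unfolded x_def]]] bcl])
        (use ev in \<open>auto elim: eventually_mono\<close>)
    \<comment> \<open>At a regular end point the line would remain characteristic beyond it, against
      the maximality of the leaf.\<close>
    have "x \<in> singular_set \<Sigma>"
    proof (rule ccontr)
      assume "x \<notin> singular_set \<Sigma>"
      then have "x \<in> regular_part \<Sigma>" using x\<Sigma> by (simp add: regular_part_def)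
      moreover have "contact_form x u = 0" using hor by (simp add: x_def)
      ultimately obtain B e \<delta> where "\<delta> > 0" "char_field \<Sigma> B e"
        "\<And>s. \<bar>s\<bar> < \<delta> \<Longrightarrow> x + s *\<^sub>R u \<in> \<Sigma> \<inter> B \<and> e (x + s *\<^sub>R u) = u"
        using char_line_extends[OF min x\<Sigma> xU _ _ unit dgx] by metis
      then have "b \<in> J"
        using leaf_not_extendable[OF leaf line bcl, of \<delta> B e] by (simp add: x_def algebra_simps)
      with bJ show False by simp
    qed
    then have "x \<in> \<Gamma>" using U0(3) xR R by auto
    \<comment> \<open>The full straight line is the smooth extension.\<close>
    then show "extends_smoothly_to J c \<Gamma>"
      unfolding extends_smoothly_to_def
      using b(2) line smooth_on_line[of P u]
      by (intro exI[of _ b] exI[of _ UNIV] exI[of _ "\<lambda>t. P + t *\<^sub>R u"]) (auto simp: x_def is_interval_univ)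
  qed
qed

end

section \<open>From points to a neighbourhood of the singular curve\<close>

theorem theorem1p8:
  fixes \<Sigma> \<Gamma> :: "(real^3) set"
  assumes "p_minimal_surface \<Sigma>"
    and "singular_curve \<Sigma> \<Gamma>"
  shows "\<exists>W. open W \<and> \<Gamma> \<subseteq> W \<and>
           (\<forall>I c. leaf \<Sigma> I c \<and> c ` I \<inter> W \<noteq> {} \<longrightarrow> extends_smoothly_to I c \<Gamma>)"
proof -
  let ?good = "\<lambda>q. \<forall>J c. leaf \<Sigma> J c \<and> q \<in> c ` J \<longrightarrow> extends_smoothly_to J c \<Gamma>"
  have "\<exists>I (\<gamma> :: real \<Rightarrow> real^3). open I \<and> is_interval I \<and> I \<noteq> {} \<and> \<gamma> C1_differentiable_on I \<and>
      (\<forall>t\<in>I. vector_derivative \<gamma> (at t) \<noteq> 0) \<and> \<Gamma> = \<gamma> ` I"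
    and sing: "\<Gamma> \<subseteq> singular_set \<Sigma>"
    and loc: "\<forall>p\<in>\<Gamma>. \<exists>U. open U \<and> p \<in> U \<and> singular_set \<Sigma> \<inter> U = \<Gamma> \<inter> U"
    using assms(2)[unfolded singular_curve_def, THEN conjunct1]
      assms(2)[unfolded singular_curve_def, THEN conjunct2, THEN conjunct1]
      assms(2)[unfolded singular_curve_def, THEN conjunct2, THEN conjunct2] .
  then obtain I and \<gamma> :: "real \<Rightarrow> real^3" where I: "open I" "is_interval I"
    and \<gamma>: "\<gamma> C1_differentiable_on I" "\<forall>t\<in>I. vector_derivative \<gamma> (at t) \<noteq> 0"
    and \<Gamma>: "\<Gamma> = \<gamma> ` I"
    by (elim exE conjE)
  have good: "\<forall>\<^sub>F q in nhds p. ?good q" if p: "p \<in> \<Gamma>" for p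
  proof -
    obtain t0 where t0: "t0 \<in> I" "\<gamma> t0 = p" using p \<Gamma> by blast
    obtain U0 where U0: "open U0" "p \<in> U0" "singular_set \<Sigma> \<inter> U0 = \<Gamma> \<inter> U0" using loc p by blast
    have "p \<in> \<Sigma>" using p sing by (auto simp: singular_set_def)
    moreover have "smooth_surface \<Sigma>" using assms(1) by (simp add: p_minimal_surface_def)
    ultimately obtain U V \<phi> \<psi> where chart: "slice_chart \<Sigma> U V \<phi> \<psi>" "p \<in> U"
      using smooth_surface_chart by metis
    have "(\<gamma> has_vector_derivative vector_derivative \<gamma> (at t0)) (at t0)"
      using \<gamma>(1) t0(1) by (auto simp: C1_differentiable_on_eq vector_derivative_works[symmetric])
    moreover have "continuous_on I \<gamma>" by (rule C1_differentiable_imp_continuous_on[OF \<gamma>(1)])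
    moreover have "connected I" using I(2) by (simp add: is_interval_connected)
    ultimately show ?thesis
      by (intro slice_chart.leaves_near_singular_point[OF chart(1) assms(1) I(1) _ t0(1) _ _ \<gamma>(2)[rule_format, OF t0(1)]
          sing[unfolded \<Gamma>] t0(2) chart(2) U0])
  qed
  \<comment> \<open>The interior of the set of good points, which unites the neighbourhoods found at
    the single points of the curve.\<close>
  define W where "W = {q. \<forall>\<^sub>F x in nhds q. ?good x}"
  have "open W"
    unfolding W_def by (subst open_subopen) (auto simp: eventually_nhds)
  moreover have "\<Gamma> \<subseteq> W" using good by (auto simp: W_def)
  moreover have "extends_smoothly_to I c \<Gamma>" if "leaf \<Sigma> I c" "c ` I \<inter> W \<noteq> {}" for I c
    using that by (auto simp: W_def dest!: eventually_nhds_x_imp_x)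
  ultimately show ?thesis by blast
qed

end
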